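(* The solution of the Bagley-Torvik equation $$a\,y''(t)+b\;{}_{0}^{\ast}D_{t}^{3/2}y(t)+c\,y(t)=f(t),\qquad t>0,$$ with $a,b,c\in\mathbb{R}$, arbitrary external force $f(t)$, and initial conditions $y(0),y'(0)\in\mathbb{R}$, is given by $$y(t)=y_f(t)+y_c(t),$$ where $$y_f(t)=\int_0^t f(t-\tau)\left(\sum_{k=1}^{4}\frac{\exp(r_k^2\tau)\,\mathrm{erfc}(-r_k\sqrt{\tau})}{(4a\,r_k+3b)\,r_k}\right)d\tau$$ takes into account the effect of the external force $f(t)$, and $$y_c(t)=\sum_{k=1}^{4}\frac{(a\,r_k+b)\left[r_k^2\,y(0)+y'(0)\right]}{(4a\,r_k+3b)\,r_k^2}\exp(r_k^2t)\,\mathrm{erfc}(-r_k\sqrt{t})$$ takes into account the effect of the initial conditions. Also, $r_k$ $(k=1,2,3,4)$ are the $4$ different roots of the polynomial $P(r)=a\,r^{4}+b\,r^{3}+c$, which are given by $$r_{1,2}=-\frac{\beta}{4}\pm R+T_{\pm},\qquad r_{3,4}=-\frac{\beta}{4}\pm R-T_{\pm},$$ where $$\beta=\frac{b}{a},\quad \gamma=\frac{c}{a},\quad \delta=\left(9\beta^2+\sqrt{81\beta^4-768\gamma}\right)\gamma,$$ $$R=\frac12\sqrt{\left(\frac{\beta}{2}\right)^2+\left(\frac{\delta}{18}\right)^{1/3}+\frac{8\gamma}{(12\delta)^{1/3}}},$$ $$T_{\pm}=\frac12\sqrt{\frac{\beta^2}{2}-4\gamma\left(\frac{2}{3\delta}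\right)^{1/3}-\left(\frac{\delta}{18}\right)^{1/3}\mp\frac{\beta^3}{8R}}.$$
   Context: The Caputo fractional derivative of order $3/2$ is $${}_{0}^{\ast}D_{t}^{3/2}g(t)=\frac{1}{\Gamma(1/2)}\int_0^t\frac{g''(\tau)}{(t-\tau)^{1/2}}\,d\tau ,$$ where $\Gamma$ is the gamma function. The complementary error function is $\mathrm{erfc}(z)=1-\frac{2}{\sqrt{\pi}}\int_0^z e^{-u^2}\,du$, for complex $z$.
   Formalization: a is nonzero and the 4 roots are assumed different; f is locally integrable and the equation holds for almost every t (every t if f is continuous); the three cube roots use one common value of δ^(1/3) with R nonzero, as independent principal values fail when c/a<0. *)

theory Defs
  imports "HOL-Complex_Analysis.Complex_Analysis"
begin

definition caputo_3_2 :: "(real \<Rightarrow> real) \<Rightarrow> real \<Rightarrow> real" where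
  "caputo_3_2 g t =
     1 / Gamma (1/2) * integral {0..t} (\<lambda>\<tau>. deriv (deriv g) \<tau> / (t - \<tau>) powr (1/2))"

text \<open>The path is immaterial since the integrand is entire.\<close>

definition erfc :: "complex \<Rightarrow> complex" where
  "erfc z = 1 - 2 / of_real (sqrt pi) * contour_integral (linepath 0 z) (\<lambda>u. exp (- (u\<^sup>2)))"

text \<open>The equation at a single point. The values of \<^const>\<open>deriv\<close> and \<^const>\<open>integral\<close> carry
  information only where the derivatives and the integral exist, so this is demanded as well.\<close>

definition bt_equation_at ::
  "real \<Rightarrow> real \<Rightarrow> real \<Rightarrow> (real \<Rightarrow> real) \<Rightarrow> (real \<Rightarrow> real) \<Rightarrow> real \<Rightarrow> bool" where
  "bt_equation_at a b c f y t \<longleftrightarrow>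
     y differentiable at t \<and> deriv y differentiable at t \<and>
     (\<lambda>\<tau>. deriv (deriv y) \<tau> / (t - \<tau>) powr (1/2)) absolutely_integrable_on {0..t} \<and>
     a * deriv (deriv y) t + b * caputo_3_2 y t + c * y t = f t"

text \<open>Solutions for a force that is merely locally integrable (a step function, say): the
  derivative of \<open>y\<close> exists everywhere and is locally absolutely continuous on the closed half-line
  (it is the indefinite integral of the second derivative), and the equation holds almost everywhere.
  The values of \<open>y\<close> at negative arguments are irrelevant, hence the one-sided derivative at \<open>0\<close>.\<close>

definition bt_solution ::
  "real \<Rightarrow> real \<Rightarrow> real \<Rightarrow> (real \<Rightarrow> real) \<Rightarrow> real \<Rightarrow> real \<Rightarrow> (real \<Rightarrow> real) \<Rightarrow> bool" where
  "bt_solution a b c f y0 y1 y \<longleftrightarrow>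
     y 0 = y0 \<and> (y has_real_derivative y1) (at 0 within {0..}) \<and>
     (\<forall>t>0. y differentiable at t) \<and>
     (\<forall>t>0. deriv (deriv y) absolutely_integrable_on {0..t} \<and>
            deriv y t = y1 + integral {0..t} (deriv (deriv y))) \<and>
     (AE t in lebesgue. t > 0 \<longrightarrow> bt_equation_at a b c f y t)"

definition bt_poly :: "real \<Rightarrow> real \<Rightarrow> real \<Rightarrow> complex \<Rightarrow> complex" where
  "bt_poly a b c z = of_real a * z ^ 4 + of_real b * z ^ 3 + of_real c"

definition bt_force_part ::
  "real \<Rightarrow> real \<Rightarrow> (nat \<Rightarrow> complex) \<Rightarrow> (real \<Rightarrow> real) \<Rightarrow> real \<Rightarrow> complex" where
  "bt_force_part a b r f t =
     integral {0..t} (\<lambda>\<tau>. of_real (f (t - \<tau>)) *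
       (\<Sum>k=1..4. exp ((r k)\<^sup>2 * of_real \<tau>) * erfc (- r k * of_real (sqrt \<tau>)) /
                   ((4 * of_real a * r k + 3 * of_real b) * r k)))"

definition bt_initial_part ::
  "real \<Rightarrow> real \<Rightarrow> (nat \<Rightarrow> complex) \<Rightarrow> real \<Rightarrow> real \<Rightarrow> real \<Rightarrow> complex" where
  "bt_initial_part a b r y0 y1 t =
     (\<Sum>k=1..4. (of_real a * r k + of_real b) * ((r k)\<^sup>2 * of_real y0 + of_real y1) /
                 ((4 * of_real a * r k + 3 * of_real b) * (r k)\<^sup>2) *
                 exp ((r k)\<^sup>2 * of_real t) * erfc (- r k * of_real (sqrt t)))"

definition bt_delta :: "real \<Rightarrow> real \<Rightarrow> real \<Rightarrow> complex" where
  "bt_delta a b c =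
     (let \<beta> = of_real (b / a); \<gamma> = of_real (c / a)
      in (9 * \<beta>\<^sup>2 + csqrt (81 * \<beta> ^ 4 - 768 * \<gamma>)) * \<gamma>)"

text \<open>In the next definitions \<open>\<kappa>\<close> stands for \<open>\<delta>\<^sup>1\<^sup>/\<^sup>3\<close>, a cube root of \<^const>\<open>bt_delta\<close>. The three
  cube roots in the closed form, of \<open>\<delta>/18\<close>, \<open>12\<delta>\<close> and \<open>2/(3\<delta>)\<close>, have to be taken with the same
  determination of \<open>\<delta>\<^sup>1\<^sup>/\<^sup>3\<close>. Principal values have this property unless \<open>\<delta>\<close> is a negative real;
  then the principal cube root of \<open>2/(3\<delta>)\<close> does not match the other two. The square roots
  may be taken with any sign without changing the set of roots. The closed form divides by
  \<open>R\<close>, which for distinct roots vanishes only if \<open>b = 0\<close>, \<open>c/a < 0\<close> and \<open>\<kappa>\<close> is the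
  real cube root.\<close>

definition bt_R :: "real \<Rightarrow> real \<Rightarrow> real \<Rightarrow> complex \<Rightarrow> complex" where
  "bt_R a b c \<kappa> =
     (let \<beta> = of_real (b / a); \<gamma> = of_real (c / a)
      in 1/2 * csqrt ((\<beta> / 2)\<^sup>2 + \<kappa> / of_real (root 3 18) + 8 * \<gamma> / (of_real (root 3 12) * \<kappa>)))"

text \<open>The argument \<open>s\<close> is the sign of the index of \<open>T\<^sub>\<plusminus>\<close>.\<close>

definition bt_T :: "real \<Rightarrow> real \<Rightarrow> real \<Rightarrow> complex \<Rightarrow> complex \<Rightarrow> complex" where
  "bt_T a b c \<kappa> s =
     (let \<beta> = of_real (b / a); \<gamma> = of_real (c / a)
      in 1/2 * csqrt (\<beta>\<^sup>2 / 2 - 4 * \<gamma> * (of_real (root 3 (2/3)) / \<kappa>) - \<kappa> / of_real (root 3 18)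
                      - s * (\<beta> ^ 3 / (8 * bt_R a b c \<kappa>))))"

definition bt_root :: "real \<Rightarrow> real \<Rightarrow> real \<Rightarrow> complex \<Rightarrow> nat \<Rightarrow> complex" where
  "bt_root a b c \<kappa> k =
     (let \<beta> = of_real (b / a); R = bt_R a b c \<kappa>
      in if k = 1 then - \<beta> / 4 + R + bt_T a b c \<kappa> 1
         else if k = 2 then - \<beta> / 4 - R + bt_T a b c \<kappa> (- 1)
         else if k = 3 then - \<beta> / 4 + R - bt_T a b c \<kappa> 1
         else - \<beta> / 4 - R - bt_T a b c \<kappa> (- 1))"

end

theory Submission
  imports Defs
begin

text \<open>
  \<^bold>\<open>Why the formula holds.\<close> Write \<open>J\<close> for the half-integral, the convolution with
  \<open>1 / sqrt (pi t)\<close>. Since \<open>J J\<close> is integration, the Caputo derivative of \<open>y\<close> is \<open>J y''\<close>, and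
  \<open>y = y0 + y1 t + J^4 y''\<close>. Hence \<open>y\<close> solves the initial value problem iff \<open>h = y''\<close> solves

    \<open>(a + b J + c J^4) h = f - c (y0 + y1 t)\<close>,

  a Volterra equation of the second kind whose kernel is locally integrable. The operator is
  \<open>J^4 P(1/J) = a (1 - r1 J) (1 - r2 J) (1 - r3 J) (1 - r4 J)\<close> for the roots of \<open>P\<close>, and
  \<open>phi r t = exp (r^2 t) erfc (- r sqrt t)\<close> is \<open>(1 - r J)\<close> inverted at the constant \<open>1\<close>
  (\<open>conv_abel_phi\<close>). A partial fraction expansion therefore writes the resolvent kernel of the
  Volterra equation as a combination of the four functions \<open>phi\<close> and the Abel kernel
  (\<open>resolvent_equation\<close>). Applying \<open>J^4\<close> to the unit plus the resolvent gives \<open>a\<close> times the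
  Green function that is convolved with \<open>f\<close> (\<open>conv_heaviside_heaviside_resolvent\<close>). The constants
  in the expansion are the sums of \<open>r^n / P'(r)\<close> over the roots (\<open>weight_moments\<close>), most of which
  vanish.

  \<^bold>\<open>Existence and uniqueness.\<close> They are the same statement read in two directions, because kernel and
  resolvent play symmetric roles (\<open>resolvent_inverse\<close>).

  \<^bold>\<open>Regularity.\<close> For a merely locally integrable force, \<open>h\<close> is determined up to a null set, so the
  convolution algebra is done almost everywhere, and the return from \<open>h\<close> to \<open>y\<close> is Lebesgue's
  theorem that an indefinite integral is differentiable almost everywhere
  (\<open>indefinite_integral_derivative_ae\<close>). If \<open>f\<close> is continuous on the open half-line, so is \<open>h\<close>:
  convolving two functions that are singular at most at \<open>0\<close> creates no new singularity
  (\<open>conv_continuous\<close>). Both sides of the equation are then continuous and agree everywhere.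
  The values of the formula are real since conjugation permutes the roots.

  \<^bold>\<open>Roots.\<close> The closed form is Ferrari's: \<open>4 R^2 - (beta/2)^2\<close> is Cardano's solution of the cubic
  \<open>m^3 = gamma (beta^2 + 4 m)\<close>, for which the shifted quartic splits into two quadratics
  (\<open>ferrari_identity\<close>, \<open>cardano_cubic\<close>).
\<close>

section \<open>Differentiation of indefinite integrals\<close>

text \<open>A point where the difference quotients of the indefinite integral stay away from \<open>h x\<close> is an
  endpoint of arbitrarily short intervals on which the Riemann term \<open>h x (v - u)\<close> misses the integral
  by a fixed fraction of the length. Vitali's theorem picks disjoint such intervals that cover almost
  all of the bad points, and Henstock's lemma bounds their total length by any given positive number.\<close>

lemma indefinite_integral_derivative_ae:
  fixes h :: "real \<Rightarrow> real"
  assumes h: "h integrable_on {a..b}"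
  shows "negligible {x \<in> {a<..<b}. \<not> ((\<lambda>u. integral {a..u} h) has_real_derivative h x) (at x)}"
proof -
  define F where "F = (\<lambda>u. integral {a..u} h)"
  have F_diff: "integral {u..v} h = F v - F u" if "a \<le> u" "u \<le> v" "v \<le> b" for u v
    using Henstock_Kurzweil_Integration.integral_combine[of a u v h] that
      integrable_subinterval_real[OF h, of a v] by (auto simp: F_def)
  \<comment> \<open>The tag \<open>x\<close> is an endpoint, as required for one-sided difference quotients at \<open>x\<close>.\<close>
  define bad where "bad = (\<lambda>e x u v. u < v \<and> {u..v} \<subseteq> {a..b} \<and> (x = u \<or> x = v) \<and>
      \<bar>F v - F u - h x * (v - u)\<bar> > e * (v - u))"
  define E where "E = (\<lambda>e. {x \<in> {a<..<b}. \<forall>d>0. \<exists>u v. bad e x u v \<and> v - u < d})"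
  have negE: "negligible (E e)" if "e > 0" for e
    unfolding negligible_outer_le
  proof (intro allI impI)
    fix \<epsilon> :: real assume "\<epsilon> > 0"
    \<comment> \<open>Bad intervals of total length \<open>L\<close> contribute at least \<open>e L\<close> to Henstock's sum,
      so the gauge for \<open>e * \<epsilon>\<close> forces \<open>L \<le> \<epsilon>\<close>.\<close>
    with \<open>e > 0\<close> have "e * \<epsilon> > 0" by simp
    from Henstock_lemma[of h a b, OF _ this] h obtain \<gamma> where \<gamma>: "gauge \<gamma>"
      and hen: "\<And>p. \<lbrakk>p tagged_partial_division_of (cbox a b); \<gamma> fine p\<rbrakk> \<Longrightarrow>
             sum (\<lambda>(x,k). norm(measure lborel k *\<^sub>R h x - integral k h)) p < e * \<epsilon>"
      by (auto simp: cbox_interval)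
    define K where "K = {i. \<exists>x. bad e x (fst i) (snd i) \<and> {fst i..snd i} \<subseteq> \<gamma> x}"
    define cen rad where "cen = (\<lambda>i::real\<times>real. (fst i + snd i) / 2)"
      and "rad = (\<lambda>i::real\<times>real. (snd i - fst i) / 2)"
    have cb: "cball (cen i) (rad i) = {fst i..snd i}" for i
      by (simp add: cball_eq_atLeastAtMost cen_def rad_def field_simps)
    obtain C where C: "countable C" "C \<subseteq> K"
      "pairwise (\<lambda>i j. disjnt (cball (cen i) (rad i)) (cball (cen j) (rad j))) C"
      "negligible (E e - (\<Union>i\<in>C. cball (cen i) (rad i)))"
    proof (rule Vitali_covering_theorem_cballs[of K rad "E e" cen])
      fix i assume "i \<in> K" then show "0 < rad i" by (auto simp: K_def bad_def rad_def)
    next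
      fix x d :: real assume x: "x \<in> E e" and "0 < d"
      from \<gamma> have "open (\<gamma> x)" "x \<in> \<gamma> x" by (auto simp: gauge_def)
      then obtain d' where d': "d' > 0" "ball x d' \<subseteq> \<gamma> x" by (auto simp: open_contains_ball)
      have "min d d' > 0" using \<open>0 < d\<close> d' by simp
      with x have "\<exists>u v. bad e x u v \<and> v - u < min d d'" unfolding E_def by blast
      then obtain u v where uv: "bad e x u v" "v - u < d" "v - u < d'" by auto
      have "{u..v} \<subseteq> ball x d'" using uv by (auto simp: bad_def dist_real_def)
      then show "\<exists>i. i \<in> K \<and> x \<in> cball (cen i) (rad i) \<and> rad i < d"
        unfolding cb using uv d' by (intro exI[of _ "(u, v)"]) (auto simp: K_def rad_def bad_def)
    qed blast
    have "\<forall>i\<in>C. \<exists>x. bad e x (fst i) (snd i) \<and> {fst i..snd i} \<subseteq> \<gamma> x"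
      using \<open>C \<subseteq> K\<close> unfolding K_def by blast
    from bchoice[OF this] obtain tag
      where tag: "\<And>i. i \<in> C \<Longrightarrow> bad e (tag i) (fst i) (snd i) \<and> {fst i..snd i} \<subseteq> \<gamma> (tag i)"
      by blast
    have fin: "(\<Sum>i\<in>C'. measure lebesgue (cball (cen i) (rad i))) \<le> \<epsilon>" if C': "C' \<subseteq> C" "finite C'" for C'
    proof -
      define p where "p = (\<lambda>i. (tag i, {fst i..snd i})) ` C'"
      have lt: "fst i < snd i" if "i \<in> C'" for i using tag[of i] that C' by (auto simp: bad_def)
      have inj: "inj_on (\<lambda>i. (tag i, {fst i..snd i})) C'"
      proof (rule inj_onI)
        fix i j assume "i \<in> C'" "j \<in> C'" "(tag i, {fst i..snd i}) = (tag j, {fst j..snd j})"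
        moreover have "fst i < snd i" "fst j < snd j"
          using lt \<open>i \<in> C'\<close> \<open>j \<in> C'\<close> by auto
        ultimately show "i = j" by (auto simp: prod_eq_iff Icc_eq_Icc)
      qed
      have "p tagged_partial_division_of (cbox a b)"
        unfolding tagged_partial_division_of_def
      proof (intro conjI allI impI)
        show "finite p" using C' by (simp add: p_def)
      next
        fix x k assume "(x, k) \<in> p"
        then obtain i where i: "i \<in> C" "x = tag i" "k = {fst i..snd i}" using C' by (auto simp: p_def)
        show "x \<in> k" "k \<subseteq> cbox a b" using tag[OF i(1)] i by (auto simp: bad_def)
        show "\<exists>a b. k = cbox a b" using i by (metis box_real(2))
      next
        fix x1 k1 x2 k2 assume "(x1, k1) \<in> p \<and> (x2, k2) \<in> p \<and> (x1, k1) \<noteq> (x2, k2)"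
        then have p12: "(x1, k1) \<in> p" "(x2, k2) \<in> p" "(x1, k1) \<noteq> (x2, k2)" by simp_all
        from p12(1) obtain i where i: "i \<in> C'" "(x1, k1) = (tag i, {fst i..snd i})"
          unfolding p_def by (rule imageE)
        from p12(2) obtain j where j: "j \<in> C'" "(x2, k2) = (tag j, {fst j..snd j})"
          unfolding p_def by (rule imageE)
        have "i \<noteq> j" using p12(3) i(2) j(2) by metis
        have k: "k1 = {fst i..snd i}" "k2 = {fst j..snd j}" using i(2) j(2) by simp_all
        have ij: "i \<in> C" "j \<in> C" using i(1) j(1) C' by blast+
        then have "disjnt k1 k2" using C(3) \<open>i \<noteq> j\<close> ij unfolding pairwise_def cb k by blast
        then show "interior k1 \<inter> interior k2 = {}"
          using interior_subset[of k1] interior_subset[of k2] by (auto simp: disjnt_def)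
      qed
      moreover have "\<gamma> fine p" using tag C' by (auto simp: fine_def p_def)
      ultimately have "sum (\<lambda>(x,k). norm(measure lborel k *\<^sub>R h x - integral k h)) p < e * \<epsilon>" by (rule hen)
      also have "sum (\<lambda>(x,k). norm(measure lborel k *\<^sub>R h x - integral k h)) p
          = (\<Sum>i\<in>C'. \<bar>(snd i - fst i) * h (tag i) - integral {fst i..snd i} h\<bar>)"
        unfolding p_def using lt
        by (subst sum.reindex[OF inj]) (auto intro!: sum.cong simp: less_imp_le)
      finally have less: "(\<Sum>i\<in>C'. \<bar>(snd i - fst i) * h (tag i) - integral {fst i..snd i} h\<bar>) < e * \<epsilon>" .
      have "(\<Sum>i\<in>C'. e * (snd i - fst i)) \<le>
          (\<Sum>i\<in>C'. \<bar>(snd i - fst i) * h (tag i) - integral {fst i..snd i} h\<bar>)"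
      proof (rule sum_mono)
        fix i assume "i \<in> C'"
        then have "bad e (tag i) (fst i) (snd i)" using tag[of i] C' by blast
        then show "e * (snd i - fst i) \<le> \<bar>(snd i - fst i) * h (tag i) - integral {fst i..snd i} h\<bar>"
          by (auto simp: bad_def F_diff mult.commute abs_minus_commute)
      qed
      with less have "e * (\<Sum>i\<in>C'. snd i - fst i) \<le> e * \<epsilon>" by (simp add: sum_distrib_left)
      then have "(\<Sum>i\<in>C'. snd i - fst i) \<le> \<epsilon>" using \<open>e > 0\<close> by simp
      moreover have "(\<Sum>i\<in>C'. measure lebesgue (cball (cen i) (rad i))) = (\<Sum>i\<in>C'. snd i - fst i)"
        unfolding cb using lt by (intro sum.cong) (auto simp: less_imp_le)
      ultimately show ?thesis by simp
    qed
    let ?U = "\<Union>i\<in>C. cball (cen i) (rad i)"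
    have fin': "measure lebesgue (\<Union>i\<in>C'. cball (cen i) (rad i)) \<le> \<epsilon>" if "C' \<subseteq> C" "finite C'" for C'
      using measure_UNION_le[of C' "\<lambda>i. cball (cen i) (rad i)" lebesgue] fin[OF that] that by auto
    have U: "?U \<in> lmeasurable" "measure lebesgue ?U \<le> \<epsilon>"
      using fmeasurable_UN_bound[of C "\<lambda>i. cball (cen i) (rad i)" lebesgue \<epsilon>] C(1) fin'
        measure_UN_bound[of C "\<lambda>i. cball (cen i) (rad i)" lebesgue \<epsilon>] by auto
    have N: "E e - ?U \<in> lmeasurable" "measure lebesgue (E e - ?U) = 0"
      using C(4) by (auto simp: negligible_imp_measurable negligible_imp_measure0)
    show "\<exists>T. E e \<subseteq> T \<and> T \<in> lmeasurable \<and> measure lebesgue T \<le> \<epsilon>"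
      using U N measure_Un_le[of "E e - ?U" lebesgue ?U]
      by (intro exI[of _ "(E e - ?U) \<union> ?U"]) (auto intro: fmeasurable.Un simp del: Un_Diff_cancel2)
  qed
  have "{x \<in> {a<..<b}. \<not> (F has_real_derivative h x) (at x)} \<subseteq> (\<Union>n. E (1 / real (Suc n)))"
  proof (rule subsetI, rule ccontr)
    fix x assume "x \<in> {x \<in> {a<..<b}. \<not> (F has_real_derivative h x) (at x)}"
      and nE: "x \<notin> (\<Union>n. E (1 / real (Suc n)))"
    then have x: "x \<in> {a<..<b}" and nd: "\<not> (F has_real_derivative h x) (at x)" by auto
    have "(F has_derivative (\<lambda>y. h x * y)) (at x)"
      unfolding has_derivative_at_alt
    proof (intro conjI allI impI)
      show "bounded_linear ((*) (h x))" by (rule bounded_linear_mult_right)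
      fix e :: real assume "e > 0"
      then obtain n where n: "1 / real (Suc n) < e" using nat_approx_posE by blast
      from nE have "x \<notin> E (1 / real (Suc n))" by blast
      with x obtain d where d: "d > 0"
        "\<And>u v. bad (1 / real (Suc n)) x u v \<Longrightarrow> \<not> v - u < d" unfolding E_def by blast
      show "\<exists>d>0. \<forall>y. norm (y - x) < d \<longrightarrow> norm (F y - F x - h x * (y - x)) \<le> e * norm (y - x)"
      proof (intro exI[of _ "min d (min (x - a) (b - x))"] conjI allI impI)
        show "0 < min d (min (x - a) (b - x))" using d x by auto
        fix y assume y: "norm (y - x) < min d (min (x - a) (b - x))"
        have "norm (F y - F x - h x * (y - x)) \<le> 1 / real (Suc n) * norm (y - x)"
        proof (cases x y rule: linorder_cases)
          case less
          then show ?thesis using d(2)[of x y] y x unfolding bad_def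
            by (auto simp: not_less[symmetric])
        next
          case greater
          have "\<bar>F y - F x - h x * (y - x)\<bar> = \<bar>F x - F y - h x * (x - y)\<bar>"
            by (simp add: algebra_simps abs_if)
          then show ?thesis using d(2)[of y x] y x greater unfolding bad_def
            by (auto simp: not_less[symmetric])
        qed auto
        also have "\<dots> \<le> e * norm (y - x)" using n by (intro mult_right_mono) auto
        finally show "norm (F y - F x - h x * (y - x)) \<le> e * norm (y - x)" .
      qed
    qed
    then show False using nd by (simp add: has_field_derivative_def)
  qed
  moreover have "negligible (\<Union>n. E (1 / real (Suc n)))"
    by (rule negligible_countable_Union) (auto intro!: negE)
  ultimately show ?thesis unfolding F_def using negligible_subset by blast
qed

section \<open>Convolution of causal locally integrable functions\<close>

definition conv :: "(real \<Rightarrow> complex) \<Rightarrow> (real \<Rightarrow> complex) \<Rightarrow> real \<Rightarrow> complex" where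
  "conv u v t = (\<integral>x. u (t - x) * v x \<partial>lborel)"

text \<open>The integral in \<open>conv\<close> is \<open>0\<close> by convention where it diverges, which happens on a null set in
  general; identities that split a convolution need this predicate.\<close>

definition conv_exists :: "(real \<Rightarrow> complex) \<Rightarrow> (real \<Rightarrow> complex) \<Rightarrow> real \<Rightarrow> bool" where
  "conv_exists u v t \<longleftrightarrow> integrable lborel (\<lambda>x. u (t - x) * v x)"

text \<open>Functions on the half-line, extended by \<open>0\<close>; for them \<open>conv u v t\<close> is the integral of
  \<open>u (t - x) v x\<close> over \<open>{0..t}\<close>. Borel measurability, rather than Lebesgue measurability, makes
  \<open>u (t - x)\<close> measurable in both variables.\<close>

definition causal_loc_int :: "(real \<Rightarrow> complex) set" where
  "causal_loc_int = {u \<in> borel_measurable borel. (\<forall>x<0. u x = 0) \<and>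
     (\<forall>T. set_integrable lborel {..T} u)}"

abbreviation ae_eq :: "(real \<Rightarrow> complex) \<Rightarrow> (real \<Rightarrow> complex) \<Rightarrow> bool" (infix "\<doteq>" 50) where
  "u \<doteq> v \<equiv> AE x in lborel. u x = v x"

lemma causal_loc_intD:
  assumes "u \<in> causal_loc_int"
  shows "u \<in> borel_measurable borel" "x < 0 \<Longrightarrow> u x = 0" "set_integrable lborel {..T} u"
  using assms by (auto simp: causal_loc_int_def)

lemma AE_lborel_reflect:
  assumes "AE x in lborel. P x"
  shows "AE x in lborel. P (t - x :: real)"
proof -
  from assms obtain N where N: "N \<in> sets borel" "emeasure lborel N = 0" "{x. \<not> P x} \<subseteq> N"
    by (auto elim!: AE_E)
  have *: "(\<lambda>x. t - x) \<in> measurable borel borel" by simp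
  have "emeasure lborel N = emeasure (density (distr lborel borel (\<lambda>x. t + (-1) * x)) (\<lambda>_. \<bar>-1::real\<bar>)) N"
    by (subst lborel_real_affine[of "-1" t, symmetric]) auto
  also have "\<dots> = emeasure lborel ((\<lambda>x. t - x) -` N)"
    using N(1) by (subst emeasure_density) (auto simp: emeasure_distr)
  finally have "emeasure lborel ((\<lambda>x. t - x) -` N) = 0" using N by simp
  moreover have "(\<lambda>x. t - x) -` N \<in> sets borel"
    using measurable_sets[OF * N(1)] by simp
  ultimately show ?thesis
    by (intro AE_I[where N = "(\<lambda>x. t - x) -` N"]) (use N(3) in auto)
qed

lemma conv_commute: "conv u v t = conv v u t"
  unfolding conv_def
  by (subst lborel_integral_real_affine[of "-1" _ t]) (auto simp: mult.commute)

lemma conv_exists_commute: "conv_exists u v t \<longleftrightarrow> conv_exists v u t"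
  unfolding conv_exists_def
  by (subst lborel_integrable_real_affine_iff[of "-1" _ t, symmetric]) (auto simp: mult.commute)

lemma conv_cong_AE:
  assumes "u \<doteq> u'" "v \<doteq> v'"
    and [measurable]: "u \<in> borel_measurable borel" "u' \<in> borel_measurable borel"
      "v \<in> borel_measurable borel" "v' \<in> borel_measurable borel"
  shows "conv u v t = conv u' v' t"
  unfolding conv_def
proof (rule integral_cong_AE)
  show "AE x in lborel. u (t - x) * v x = u' (t - x) * v' x"
    using AE_lborel_reflect[OF assms(1), of t] assms(2) by eventually_elim simp
qed measurable

lemma conv_neg:
  assumes "u \<in> causal_loc_int" "v \<in> causal_loc_int" "t < 0"
  shows "conv u v t = 0"
proof -
  have "u (t - x) * v x = 0" for x
    using causal_loc_intD(2)[OF assms(1), of "t - x"] causal_loc_intD(2)[OF assms(2), of x] assms(3)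
    by (cases "x < 0") auto
  then show ?thesis unfolding conv_def by (simp only: integral_zero)
qed

lemma conv_exists_add_left:
  "conv_exists u w t \<Longrightarrow> conv_exists v w t \<Longrightarrow> conv_exists (\<lambda>x. u x + v x) w t"
  by (simp add: conv_exists_def ring_distribs)

lemma conv_exists_scale_left: "conv_exists u w t \<Longrightarrow> conv_exists (\<lambda>x. c * u x) w t"
  by (simp add: conv_exists_def mult.assoc)

lemma conv_add_left:
  "conv_exists u w t \<Longrightarrow> conv_exists v w t \<Longrightarrow> conv (\<lambda>x. u x + v x) w t = conv u w t + conv v w t"
  by (simp add: conv_def conv_exists_def ring_distribs)

lemma conv_scale_left: "conv (\<lambda>x. c * u x) w t = c * conv u w t"
  by (simp add: conv_def mult.assoc)

lemma conv_add_right: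
  "conv_exists w u t \<Longrightarrow> conv_exists w v t \<Longrightarrow> conv w (\<lambda>x. u x + v x) t = conv w u t + conv w v t"
  by (simp add: conv_def conv_exists_def ring_distribs)

lemma conv_scale_right: "conv w (\<lambda>x. c * u x) t = c * conv w u t"
  by (simp add: conv_def mult.left_commute)

lemma conv_exists_sum_left:
  "(\<And>i. i \<in> I \<Longrightarrow> conv_exists (u i) w t) \<Longrightarrow> conv_exists (\<lambda>x. \<Sum>i\<in>I. c i * u i x) w t"
  by (auto simp: conv_exists_def sum_distrib_right mult.assoc)

lemma conv_sum_left:
  "(\<And>i. i \<in> I \<Longrightarrow> conv_exists (u i) w t) \<Longrightarrow>
     conv (\<lambda>x. \<Sum>i\<in>I. c i * u i x) w t = (\<Sum>i\<in>I. c i * conv (u i) w t)"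
  by (auto simp: conv_def conv_exists_def sum_distrib_right mult.assoc)

lemma causal_loc_int_add:
  "u \<in> causal_loc_int \<Longrightarrow> v \<in> causal_loc_int \<Longrightarrow> (\<lambda>x. u x + v x) \<in> causal_loc_int"
  by (auto simp: causal_loc_int_def)

lemma causal_loc_int_scale: "u \<in> causal_loc_int \<Longrightarrow> (\<lambda>x. c * u x) \<in> causal_loc_int"
  by (auto simp: causal_loc_int_def)

lemma causal_loc_int_sum:
  "(\<And>i. i \<in> I \<Longrightarrow> u i \<in> causal_loc_int) \<Longrightarrow> (\<lambda>x. \<Sum>i\<in>I. c i * u i x) \<in> causal_loc_int"
proof (induction I rule: infinite_finite_induct)
  case (insert i I)
  then show ?case using causal_loc_int_add[OF causal_loc_int_scale[of "u i" "c i"], of "\<lambda>x. \<Sum>i\<in>I. c i * u i x"]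
    by auto
qed (simp_all add: causal_loc_int_def set_integrable_def)

text \<open>Translation invariance: for fixed \<open>x\<close> the integral over \<open>t\<close> is that of \<open>u\<close>.\<close>

lemma integrable_conv_kernel:
  fixes u v :: "real \<Rightarrow> complex"
  assumes u: "integrable lborel u" and v: "integrable lborel v"
  shows "integrable (lborel \<Otimes>\<^sub>M lborel) (\<lambda>(x, t). u (t - x) * v x)"
proof (rule lborel_pair.Fubini_integrable)
  have [measurable]: "u \<in> borel_measurable borel" "v \<in> borel_measurable borel"
    using u v by (auto dest: borel_measurable_integrable)
  show "(\<lambda>(x, t). u (t - x) * v x) \<in> borel_measurable (lborel \<Otimes>\<^sub>M lborel)" by measurable
  have *: "integrable lborel (\<lambda>t. u (t - x))" for x
    using lborel_integrable_real_affine[OF u, of 1 "-x"] by (simp add: add.commute)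
  have **: "(\<integral>t. norm (u (t - x)) \<partial>lborel) = (\<integral>t. norm (u t) \<partial>lborel)" for x
    using lborel_integral_real_affine[of 1 "\<lambda>t. norm (u t)" "-x"] by (simp add: add.commute)
  show "integrable lborel (\<lambda>x. \<integral>y. norm (case (x, y) of (x, t) \<Rightarrow> u (t - x) * v x) \<partial>lborel)"
    using v by (simp add: norm_mult **)
  show "AE x in lborel. integrable lborel (\<lambda>y. case (x, y) of (x, t) \<Rightarrow> u (t - x) * v x)"
    using * by simp
qed

text \<open>Up to time \<open>T\<close> a convolution does not see its factors beyond \<open>T\<close>. This reduces local
  integrability to integrability on the whole line.\<close>

lemma conv_trunc:
  assumes "u \<in> causal_loc_int" "v \<in> causal_loc_int" "t \<le> T"
  shows "u (t - x) * v x = (indicator {..T} (t - x) *\<^sub>R u (t - x)) * (indicator {..T} x *\<^sub>R v x)"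
  using causal_loc_intD(2)[OF assms(1), of "t - x"] causal_loc_intD(2)[OF assms(2), of x] assms(3)
  by (cases "x < 0"; cases "t - x < 0") (auto simp: indicator_def)

lemma conv_loc_int:
  assumes u: "u \<in> causal_loc_int" and v: "v \<in> causal_loc_int"
  shows "AE t in lborel. conv_exists u v t" "conv u v \<in> causal_loc_int"
proof -
  have [measurable]: "u \<in> borel_measurable borel" "v \<in> borel_measurable borel"
    using assms by (auto simp: causal_loc_int_def)
  define uT vT where "uT = (\<lambda>T x. indicator {..T} x *\<^sub>R u x)"
    and "vT = (\<lambda>T x. indicator {..T} x *\<^sub>R v x)"
  have int: "integrable lborel (uT T)" "integrable lborel (vT T)" for T
    using assms by (auto simp: causal_loc_int_def set_integrable_def uT_def vT_def)
  have tr: "u (t - x) * v x = uT T (t - x) * vT T x" if "t \<le> T" for t T x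
    using conv_trunc[OF u v that] by (simp add: uT_def vT_def)
  note K = integrable_conv_kernel[OF int]
  have "AE t in lborel. \<forall>n. t \<le> real n \<longrightarrow> conv_exists u v t"
  proof (subst AE_all_countable, intro allI)
    fix n :: nat
    have "AE t in lborel. integrable lborel (\<lambda>x. uT n (t - x) * vT n x)"
      using lborel_pair.AE_integrable_snd[OF K] by simp
    then show "AE t in lborel. t \<le> real n \<longrightarrow> conv_exists u v t"
      by eventually_elim (auto simp: conv_exists_def tr[symmetric])
  qed
  then show "AE t in lborel. conv_exists u v t"
    by eventually_elim (use real_arch_simple in blast)
  have "set_integrable lborel {..T} (conv u v)" for T
  proof -
    have "integrable lborel (\<lambda>t. \<integral>x. uT T (t - x) * vT T x \<partial>lborel)"
      using lborel_pair.integrable_snd[OF K] by simp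
    then have "set_integrable lborel {..T} (\<lambda>t. \<integral>x. uT T (t - x) * vT T x \<partial>lborel)"
      unfolding set_integrable_def by (intro integrable_mult_indicator) auto
    also have "?this \<longleftrightarrow> ?thesis"
      by (rule set_integrable_cong) (auto simp: conv_def tr[symmetric])
    finally show ?thesis .
  qed
  moreover have "conv u v \<in> borel_measurable borel" unfolding conv_def[abs_def] by measurable
  ultimately show "conv u v \<in> causal_loc_int"
    using conv_neg[OF u v] by (auto simp: causal_loc_int_def)
qed

definition loc_bounded :: "(real \<Rightarrow> complex) \<Rightarrow> bool" where
  "loc_bounded u \<longleftrightarrow> (\<forall>T. \<exists>B. \<forall>x\<le>T. norm (u x) \<le> B)"

lemma conv_exists_bounded:
  assumes u: "u \<in> causal_loc_int" and v: "v \<in> causal_loc_int" and b: "loc_bounded u"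
  shows "conv_exists u v t"
proof -
  have [measurable]: "u \<in> borel_measurable borel" "v \<in> borel_measurable borel"
    using assms by (auto simp: causal_loc_int_def)
  from b obtain B where B: "\<And>x. x \<le> t \<Longrightarrow> norm (u x) \<le> B" unfolding loc_bounded_def by metis
  have "integrable lborel (\<lambda>x. (indicator {..t} (t - x) *\<^sub>R u (t - x)) * (indicator {..t} x *\<^sub>R v x))"
  proof (rule Bochner_Integration.integrable_bound)
    show "integrable lborel (\<lambda>x. B *\<^sub>R (indicator {..t} x *\<^sub>R v x))"
      using causal_loc_intD(3)[OF v, of t] unfolding set_integrable_def
      by (rule integrable_scaleR_right)
    have "norm ((indicator {..t} (t - x) *\<^sub>R u (t - x)) * (indicator {..t} x *\<^sub>R v x))
         \<le> norm (B *\<^sub>R (indicator {..t} x *\<^sub>R v x))" for x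
      using B[of "t - x"] order_trans[OF norm_ge_zero B[of "t - x"]]
      by (auto simp: indicator_def norm_mult intro!: mult_right_mono)
    then show "AE x in lborel. norm ((indicator {..t} (t - x) *\<^sub>R u (t - x)) * (indicator {..t} x *\<^sub>R v x))
         \<le> norm (B *\<^sub>R (indicator {..t} x *\<^sub>R v x))" by simp
  qed measurable
  then show ?thesis unfolding conv_exists_def conv_trunc[OF u v order_refl] .
qed

text \<open>Both sides are iterated integrals of \<open>u (t - x) v (x - y) w y\<close>. The existence assumption is
  exactly the absolute convergence that Fubini's theorem asks for.\<close>

lemma conv_assoc_at:
  assumes u: "u \<in> causal_loc_int" and v: "v \<in> causal_loc_int" and w: "w \<in> causal_loc_int"
    and ex: "conv_exists u (conv (\<lambda>x. of_real (norm (v x))) (\<lambda>x. of_real (norm (w x)))) t"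
  shows "conv u (conv v w) t = conv (conv u v) w t"
proof -
  have [measurable]: "u \<in> borel_measurable borel" "v \<in> borel_measurable borel" "w \<in> borel_measurable borel"
    using assms by (auto simp: causal_loc_int_def)
  have int: "integrable (lborel \<Otimes>\<^sub>M lborel) (\<lambda>(x, y). u (t - x) * (v (x - y) * w y))"
  proof (rule lborel_pair.Fubini_integrable)
    show "AE x in lborel. integrable lborel (\<lambda>y. case (x, y) of (x, y) \<Rightarrow> u (t - x) * (v (x - y) * w y))"
      using conv_loc_int(1)[OF v w] by eventually_elim (auto simp: conv_exists_def)
    have "(\<integral>y. complex_of_real (norm (v (x - y))) * of_real (norm (w y)) \<partial>lborel)
        = of_real (\<integral>y. norm (v (x - y)) * norm (w y) \<partial>lborel)" for x
      unfolding of_real_mult[symmetric] by (rule integral_complex_of_real)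
    then have *: "conv (\<lambda>x. of_real (norm (v x))) (\<lambda>x. of_real (norm (w x))) x
        = of_real (\<integral>y. norm (v (x - y)) * norm (w y) \<partial>lborel)" for x
      by (simp add: conv_def)
    have "integrable lborel (\<lambda>x. norm (u (t - x) * of_real (\<integral>y. norm (v (x - y)) * norm (w y) \<partial>lborel)))"
      using ex unfolding conv_exists_def * by (rule integrable_norm)
    then show "integrable lborel (\<lambda>x. \<integral>y. norm (case (x, y) of (x, y) \<Rightarrow> u (t - x) * (v (x - y) * w y)) \<partial>lborel)"
      by (simp add: norm_mult)
  qed measurable
  have "conv u (conv v w) t = (\<integral>x. (\<integral>y. u (t - x) * (v (x - y) * w y) \<partial>lborel) \<partial>lborel)"
    by (simp add: conv_def)
  also have "\<dots> = (\<integral>y. (\<integral>x. u (t - x) * (v (x - y) * w y) \<partial>lborel) \<partial>lborel)"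
    by (rule lborel_pair.Fubini_integral[OF int, symmetric])
  also have "\<dots> = (\<integral>y. (\<integral>x. u (t - y - x) * v x \<partial>lborel) * w y \<partial>lborel)"
  proof (intro Bochner_Integration.integral_cong refl)
    fix y
    have "(\<integral>x. u (t - x) * (v (x - y) * w y) \<partial>lborel) = (\<integral>x. u (t - (y + x)) * (v x * w y) \<partial>lborel)"
      by (subst lborel_integral_real_affine[of 1 _ y]) auto
    then show "(\<integral>x. u (t - x) * (v (x - y) * w y) \<partial>lborel) = (\<integral>x. u (t - y - x) * v x \<partial>lborel) * w y"
      by (simp add: mult.assoc[symmetric] diff_diff_eq)
  qed
  also have "\<dots> = conv (conv u v) w t" by (simp add: conv_def)
  finally show ?thesis .
qed

lemma causal_loc_int_norm:
  assumes u: "u \<in> causal_loc_int"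
  shows "(\<lambda>x. of_real (norm (u x))) \<in> causal_loc_int"
proof -
  have [measurable]: "u \<in> borel_measurable borel" using u by (rule causal_loc_intD)
  have "set_integrable lborel {..T} (\<lambda>x. complex_of_real (norm (u x)))" for T
    using set_integrable_norm[OF causal_loc_intD(3)[OF u, of T]]
    by (auto simp: set_integrable_def scaleR_conv_of_real simp flip: of_real_mult)
  then show ?thesis using causal_loc_intD(2)[OF u] by (auto simp: causal_loc_int_def)
qed

lemma conv_assoc_AE:
  assumes "u \<in> causal_loc_int" "v \<in> causal_loc_int" "w \<in> causal_loc_int"
  shows "conv u (conv v w) \<doteq> conv (conv u v) w"
  using conv_loc_int(1)[OF assms(1) conv_loc_int(2)[OF assms(2,3)[THEN causal_loc_int_norm]]]
  by eventually_elim (rule conv_assoc_at[OF assms])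

lemma conv_assoc_bounded:
  assumes "u \<in> causal_loc_int" "v \<in> causal_loc_int" "w \<in> causal_loc_int" "loc_bounded u"
  shows "conv u (conv v w) t = conv (conv u v) w t"
  by (intro conv_assoc_at assms conv_exists_bounded conv_loc_int(2) causal_loc_int_norm)


text \<open>Dominated convergence: the values \<open>u (s - x)\<close> are uniformly bounded near \<open>s = t\<close> and converge
  for almost every \<open>x\<close>, so jumps of \<open>u\<close> do no harm.\<close>

lemma conv_isCont:
  assumes u: "u \<in> causal_loc_int" and v: "v \<in> causal_loc_int" and b: "loc_bounded u"
    and cont: "AE x in lborel. isCont u x"
  shows "isCont (conv u v) t"
  unfolding continuous_at_sequentially
proof (intro allI impI)
  fix X :: "nat \<Rightarrow> real" assume X: "X \<longlonglongrightarrow> t"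
  have [measurable]: "u \<in> borel_measurable borel" "v \<in> borel_measurable borel"
    using assms by (auto simp: causal_loc_int_def)
  from X have "bounded (range X)" by (rule convergent_imp_bounded)
  then obtain T where T: "\<And>n. X n \<le> T" by (auto simp: bounded_real dest: abs_le_D1)
  have tT: "t \<le> T" by (rule LIMSEQ_le_const2[OF X]) (use T in auto)
  from b obtain B where B: "\<And>x. x \<le> T \<Longrightarrow> norm (u x) \<le> B" unfolding loc_bounded_def by metis
  have B0: "B \<ge> 0" using order_trans[OF norm_ge_zero B[of T]] by simp
  have "(\<lambda>n. conv u v (X n)) \<longlonglongrightarrow> conv u v t"
    unfolding conv_def
  proof (rule integral_dominated_convergence)
    show "integrable lborel (\<lambda>x. B * norm (indicator {..T} x *\<^sub>R v x))"
      using causal_loc_intD(3)[OF v, of T] unfolding set_integrable_def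
      by (intro integrable_mult_right integrable_norm)
    show "AE x in lborel. (\<lambda>n. u (X n - x) * v x) \<longlonglongrightarrow> u (t - x) * v x"
      using AE_lborel_reflect[OF cont, of t]
    proof eventually_elim
      case (elim x)
      have "(\<lambda>n. X n - x) \<longlonglongrightarrow> t - x" by (intro tendsto_intros X)
      from isCont_tendsto_compose[OF elim this] show ?case by (intro tendsto_intros)
    qed
    fix n
    have "norm (u (X n - x) * v x) \<le> B * norm (indicator {..T} x *\<^sub>R v x)" for x
      using B[of "X n - x"] T[of n] B0 causal_loc_intD(2)[OF v, of x]
        causal_loc_intD(2)[OF u, of "X n - x"]
      by (cases "x < 0"; cases "x \<le> T") (auto simp: norm_mult intro!: mult_right_mono)
    then show "AE x in lborel. norm (u (X n - x) * v x) \<le> B * norm (indicator {..T} x *\<^sub>R v x)"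
      by simp
  qed measurable
  then show "(conv u v \<circ> X) \<longlonglongrightarrow> conv u v t" by (simp add: o_def)
qed

text \<open>Cutting off a neighbourhood of \<open>0\<close> removes the only possible singularity, at the price of one jump.\<close>

lemma causal_loc_int_tail:
  assumes u: "u \<in> causal_loc_int" and c: "continuous_on {0<..} u" and d: "d > 0"
  shows "(\<lambda>x. indicator {d<..} x * u x) \<in> causal_loc_int"
    "loc_bounded (\<lambda>x. indicator {d<..} x * u x)"
    "AE x in lborel. isCont (\<lambda>x. indicator {d<..} x * u x) x"
proof -
  let ?w = "\<lambda>x. indicator {d<..} x * u x"
  have [measurable]: "u \<in> borel_measurable borel" using assms by (auto simp: causal_loc_int_def)
  have "set_integrable lborel {..T} ?w" for T
  proof -
    have "set_integrable lborel ({..T} \<inter> {d<..}) u"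
      by (rule set_integrable_subset[OF causal_loc_intD(3)[OF u, of T]]) auto
    then show ?thesis by (simp add: set_integrable_def indicator_inter_arith scaleR_conv_of_real mult.assoc of_real_indicator)
  qed
  then show "?w \<in> causal_loc_int" using causal_loc_intD(2)[OF u] by (auto simp: causal_loc_int_def)
  show "loc_bounded ?w"
    unfolding loc_bounded_def
  proof
    fix T
    have "compact (u ` {d..T})"
      using d by (intro compact_continuous_image continuous_on_subset[OF c]) auto
    then obtain B where "\<And>x. x \<in> {d..T} \<Longrightarrow> norm (u x) \<le> B"
      by (meson bounded_iff compact_imp_bounded imageI)
    then have "norm (?w x) \<le> max B 0" if "x \<le> T" for x using that by (auto simp: indicator_def le_max_iff_disj)
    then show "\<exists>B. \<forall>x\<le>T. norm (?w x) \<le> B" by blast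
  qed
  have "isCont ?w x" if "x \<noteq> d" for x
  proof (cases "x < d")
    case True
    have "eventually (\<lambda>y. y \<in> {..<d}) (nhds x)" using True by (intro eventually_nhds_in_open) auto
    then have "eventually (\<lambda>y. ?w y = 0) (nhds x)" by eventually_elim auto
    then show ?thesis by (subst isCont_cong[of _ "\<lambda>_. 0"]) auto
  next
    case False
    have "eventually (\<lambda>y. y \<in> {d<..}) (nhds x)" using False that by (intro eventually_nhds_in_open) auto
    then have "eventually (\<lambda>y. ?w y = u y) (nhds x)" by eventually_elim auto
    moreover have "isCont u x" using c d False that by (auto simp: continuous_on_eq_continuous_at)
    ultimately show ?thesis by (subst isCont_cong[of _ u]) auto
  qed
  then show "AE x in lborel. isCont ?w x"
    by (intro eventually_mono[OF AE_lborel_singleton[of d]])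
qed

text \<open>In \<open>u (t - x) v x\<close> the two arguments add up to \<open>t > 0\<close>, so they cannot both be close to \<open>0\<close>:
  the convolution splits into two terms, each with one factor cut off near \<open>0\<close>.\<close>

lemma conv_continuous:
  assumes u: "u \<in> causal_loc_int" "continuous_on {0<..} u"
    and v: "v \<in> causal_loc_int" "continuous_on {0<..} v"
  shows "t > 0 \<Longrightarrow> conv_exists u v t" "continuous_on {0<..} (conv u v)"
proof -
  have *: "conv_exists u v t \<and> isCont (conv u v) t" if "t > 0" for t
  proof -
    \<comment> \<open>If \<open>s > 2 d\<close>, then \<open>x \<le> d\<close> implies \<open>s - x > d\<close>.\<close>
    define d where "d = t / 3"
    have d: "d > 0" "2 * d < t" using that by (auto simp: d_def)
    let ?u = "\<lambda>x. indicator {d<..} x * u x" and ?v = "\<lambda>x. indicator {d<..} x * v x"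
    define v' where "v' = (\<lambda>x. v x + (-1) * ?v x)"
    note tu = causal_loc_int_tail[OF u d(1)] and tv = causal_loc_int_tail[OF v d(1)]
    have v': "v' \<in> causal_loc_int" unfolding v'_def
      by (intro causal_loc_int_add causal_loc_int_scale v tv)
    have eq: "u (s - x) * v x = ?u (s - x) * v' x + u (s - x) * ?v x" if "s > 2 * d" for s x
      using that by (auto simp: v'_def indicator_def)
    have ex: "conv_exists ?u v' s" "conv_exists u ?v s" for s
      using conv_exists_bounded[OF tu(1) v' tu(2)] conv_exists_bounded[OF tv(1) u(1) tv(2)]
      by (auto simp: conv_exists_commute)
    have 1: "conv_exists u v s" "conv u v s = conv ?u v' s + conv ?v u s" if "s > 2 * d" for s
      using ex[of s] conv_commute[of ?v u s] unfolding conv_exists_def conv_def eq[OF that] by simp_all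
    have "eventually (\<lambda>s. s \<in> {2 * d<..}) (nhds t)" using d by (intro eventually_nhds_in_open) auto
    then have "eventually (\<lambda>s. conv u v s = conv ?u v' s + conv ?v u s) (nhds t)"
      by eventually_elim (rule 1, simp)
    moreover have "isCont (\<lambda>s. conv ?u v' s + conv ?v u s) t"
      by (intro continuous_intros conv_isCont tu tv v' u)
    ultimately show ?thesis using 1(1)[of t] d by (subst isCont_cong) auto
  qed
  then show "t > 0 \<Longrightarrow> conv_exists u v t" "continuous_on {0<..} (conv u v)"
    by (auto simp: continuous_on_eq_continuous_at)
qed

lemma set_integrable_lebesgue_iff:
  fixes f :: "real \<Rightarrow> 'a :: euclidean_space"
  assumes [measurable]: "f \<in> borel_measurable borel" "S \<in> sets borel"
  shows "f absolutely_integrable_on S \<longleftrightarrow> set_integrable lborel S f"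
  unfolding set_integrable_def by (rule integrable_completion) measurable

lemma conv_eq_integral:
  assumes u: "u \<in> causal_loc_int" and v: "v \<in> causal_loc_int" and ex: "conv_exists u v t"
  shows "(\<lambda>x. u (t - x) * v x) absolutely_integrable_on {0..t}"
    "integral {0..t} (\<lambda>x. u (t - x) * v x) = conv u v t"
proof -
  have [measurable]: "u \<in> borel_measurable borel" "v \<in> borel_measurable borel"
    using assms by (auto simp: causal_loc_int_def)
  have eq: "indicator {0..t} x *\<^sub>R (u (t - x) * v x) = u (t - x) * v x" for x
    using causal_loc_intD(2)[OF v, of x] causal_loc_intD(2)[OF u, of "t - x"]
    by (cases "x < 0"; cases "t < x") (auto simp: indicator_def)
  have si: "set_integrable lborel {0..t} (\<lambda>x. u (t - x) * v x)"
    using ex unfolding set_integrable_def conv_exists_def eq .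
  then show "(\<lambda>x. u (t - x) * v x) absolutely_integrable_on {0..t}"
    by (subst set_integrable_lebesgue_iff) auto
  show "integral {0..t} (\<lambda>x. u (t - x) * v x) = conv u v t"
    using set_borel_integral_eq_integral(2)[OF si] unfolding set_lebesgue_integral_def conv_def eq by simp
qed

text \<open>In the algebra with a unit \<open>\<delta>\<close> adjoined, the hypothesis says \<open>(\<delta> + P) (\<delta> + Q) = \<delta>\<close>. As it is
  symmetric in \<open>P\<close> and \<open>Q\<close>, the lemma solves the Volterra equation with kernel \<open>P\<close>, and
  with the kernels exchanged it shows uniqueness.\<close>

lemma resolvent_inverse:
  assumes P: "P \<in> causal_loc_int" and Q: "Q \<in> causal_loc_int"
    and g: "g \<in> causal_loc_int" and h: "h \<in> causal_loc_int"
    and res: "AE t in lborel. P t + Q t + conv P Q t = 0"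
    and hg: "AE t in lborel. h t = g t + conv Q g t"
  shows "AE t in lborel. h t + conv P h t = g t"
proof -
  have [measurable]: "P \<in> borel_measurable borel" "Q \<in> borel_measurable borel"
    using P Q by (auto intro: causal_loc_intD)
  note LI = P Q g h conv_loc_int(2)[OF P Q] conv_loc_int(2)[OF Q g]
  have 1: "conv P h t = conv P (\<lambda>t. g t + conv Q g t) t" for t
    by (rule conv_cong_AE[OF _ hg]) (auto intro: causal_loc_intD LI causal_loc_int_add)
  have 2: "conv (conv P Q) g t = conv (\<lambda>t. (-1) * P t + (-1) * Q t) g t" for t
  proof (rule conv_cong_AE)
    show "conv P Q \<doteq> (\<lambda>t. (-1) * P t + (-1) * Q t)"
      using res by eventually_elim (simp add: add_eq_0_iff)
  qed (auto intro: causal_loc_intD LI)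
  show ?thesis
    using hg conv_loc_int(1)[OF P g] conv_loc_int(1)[OF P LI(6)] conv_loc_int(1)[OF Q g]
      conv_assoc_AE[OF P Q g]
  proof eventually_elim
    case (elim t)
    have "conv P h t = conv P g t + conv P (conv Q g) t"
      unfolding 1 using elim(2,3) by (rule conv_add_right)
    also have "conv P (conv Q g) t = (-1) * conv P g t + (-1) * conv Q g t"
      unfolding elim(5) 2 using elim(2,4)
      by (simp only: conv_add_left conv_scale_left conv_exists_scale_left)
    finally show ?case using elim(1) by simp
  qed
qed

section \<open>The functions \<open>exp (r^2 t) erfc (- r sqrt t)\<close>\<close>

text \<open>The only discontinuity is the possible jump at \<open>0\<close>.\<close>

lemma causal_extension:
  assumes g: "continuous_on {0..} g" and u: "\<And>x. u x = (if x \<ge> 0 then g x else 0)"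
  shows "u \<in> causal_loc_int" "loc_bounded u" "AE x in lborel. isCont u x" "continuous_on {0..} u"
proof -
  have c: "continuous_on {0..} u" using g by (rule continuous_on_eq) (simp add: u)
  then show "continuous_on {0..} u" .
  have bd: "\<exists>B. \<forall>x\<le>T. norm (u x) \<le> B" for T
  proof -
    have "compact (u ` {0..T})"
      by (intro compact_continuous_image continuous_on_subset[OF c]) auto
    then obtain B where "\<And>x. x \<in> {0..T} \<Longrightarrow> norm (u x) \<le> B"
      by (meson bounded_iff compact_imp_bounded imageI)
    then have "norm (u x) \<le> max B 0" if "x \<le> T" for x using that by (cases "x < 0") (auto simp: u le_max_iff_disj)
    then show ?thesis by blast
  qed
  then show "loc_bounded u" by (simp add: loc_bounded_def)
  have ueq: "u = (\<lambda>x. indicator {0..} x *\<^sub>R g x)" by (auto simp: u)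
  have meas: "u \<in> borel_measurable borel"
    unfolding ueq by (rule borel_measurable_continuous_on_indicator) (auto intro: g)
  have "set_integrable lborel {..T} u" for T
  proof -
    have "set_integrable lborel {0..T} u"
      unfolding set_integrable_def
      by (rule borel_integrable_compact) (auto intro: continuous_on_subset[OF c])
    also have "?this \<longleftrightarrow> ?thesis" unfolding set_integrable_def
      by (rule arg_cong[where f = "integrable lborel"]) (auto simp: u indicator_def fun_eq_iff)
    finally show ?thesis .
  qed
  with meas show "u \<in> causal_loc_int" by (auto simp: causal_loc_int_def u)
  have "isCont u x" if "x \<noteq> 0" for x
  proof (cases "x < 0")
    case True
    have "eventually (\<lambda>y. y \<in> {..<0}) (nhds x)" using True by (intro eventually_nhds_in_open) auto
    then have "eventually (\<lambda>y. u y = 0) (nhds x)" by eventually_elim (auto simp: u)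
    then show ?thesis by (subst isCont_cong[of _ "\<lambda>_. 0"]) auto
  next
    case False
    with that have "x \<in> {0<..}" by auto
    moreover have "continuous_on {0<..} u" by (rule continuous_on_subset[OF c]) auto
    ultimately show ?thesis by (auto simp: continuous_on_eq_continuous_at)
  qed
  then show "AE x in lborel. isCont u x" by (intro eventually_mono[OF AE_lborel_singleton[of 0]])
qed

definition heaviside :: "real \<Rightarrow> complex" where "heaviside x = (if x \<ge> 0 then 1 else 0)"

definition abel_kernel :: "real \<Rightarrow> complex" where
  "abel_kernel x = (if x > 0 then of_real (1 / (sqrt pi * sqrt x)) else 0)"

text \<open>With \<open>z = r sqrt t\<close> these are the values \<open>E(z)\<close> of the Mittag-Leffler function of order \<open>1/2\<close>,
  the half-integral analogue of the exponential function.\<close>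

definition phi :: "complex \<Rightarrow> real \<Rightarrow> complex" where
  "phi r t = (if t \<ge> 0 then exp (r\<^sup>2 * of_real t) * erfc (- r * of_real (sqrt t)) else 0)"

lemma heaviside_regular: "heaviside \<in> causal_loc_int" "loc_bounded heaviside" "AE x in lborel. isCont heaviside x"
  using causal_extension[of "\<lambda>_. 1" heaviside] by (auto simp: heaviside_def)

lemma continuous_on_abel_kernel: "continuous_on {0<..} abel_kernel"
proof -
  have "continuous_on {0<..} (\<lambda>x. complex_of_real (1 / (sqrt pi * sqrt x)))"
    by (intro continuous_intros) auto
  then show ?thesis by (rule continuous_on_eq) (simp add: abel_kernel_def)
qed

lemma abel_kernel_loc_int: "abel_kernel \<in> causal_loc_int"
proof -
  have [measurable]: "abel_kernel \<in> borel_measurable borel" unfolding abel_kernel_def by measurable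
  have "set_integrable lborel {..T} abel_kernel" for T
  proof -
    have "(\<lambda>x. x powr (-1/2)) integrable_on {0..max T 0}"
      by (rule integrable_on_powr_from_0) auto
    then have "(\<lambda>x. x powr (-1/2)) absolutely_integrable_on {0..max T 0}"
      by (rule nonnegative_absolutely_integrable_1) auto
    then have "set_integrable lborel {0..max T 0} (\<lambda>x. x powr (-1/2))"
      by (subst (asm) set_integrable_lebesgue_iff) auto
    then have "integrable lborel (\<lambda>x. complex_of_real (1 / sqrt pi * (indicator {0..max T 0} x *\<^sub>R x powr (-1/2))))"
      unfolding set_integrable_def by (intro integrable_of_real integrable_mult_right)
    then show ?thesis unfolding set_integrable_def
    proof (rule Bochner_Integration.integrable_bound)
      show "AE x in lborel. norm (indicator {..T} x *\<^sub>R abel_kernel x)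
          \<le> norm (complex_of_real (1 / sqrt pi * (indicator {0..max T 0} x *\<^sub>R x powr (-1/2))))"
        by (intro AE_I2) (auto simp: indicator_def abel_kernel_def powr_minus powr_half_sqrt norm_divide
            norm_mult divide_simps)
    qed measurable
  qed
  then show ?thesis by (auto simp: causal_loc_int_def abel_kernel_def)
qed

lemma Beta_half: "Beta (1/2) (1/2) = (pi::real)"
  by (simp add: Beta_def Gamma_one_half_real)

text \<open>The half-integral of the Abel kernel is the complete Beta integral \<open>B(1/2, 1/2) = pi\<close>,
  divided by \<open>pi\<close>.\<close>

lemma conv_abel_abel: "conv abel_kernel abel_kernel \<doteq> heaviside"
proof -
  have "conv abel_kernel abel_kernel t = heaviside t" if "t \<noteq> 0" for t
  proof (cases "t < 0")
    case True
    then show ?thesis using conv_neg[OF abel_kernel_loc_int abel_kernel_loc_int] by (simp add: heaviside_def)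
  next
    case False
    with that have t: "t > 0" by simp
    let ?f = "\<lambda>x::real. x powr (1/2 - 1) * (1 - x) powr (1/2 - 1)"
    have hi: "(?f has_integral pi) {0..1}" using has_integral_Beta_real[of "1/2" "1/2"] Beta_half by simp
    then have "?f absolutely_integrable_on {0..1}"
      by (intro nonnegative_absolutely_integrable_1) (auto simp: has_integral_integrable)
    then have si: "set_integrable lborel {0..1} ?f"
      by (subst (asm) set_integrable_lebesgue_iff) auto
    have "conv abel_kernel abel_kernel t
       = t *\<^sub>R (\<integral>x. abel_kernel (t - t * x) * abel_kernel (t * x) \<partial>lborel)"
      unfolding conv_def using t by (subst lborel_integral_real_affine[of t _ 0]) auto
    also have "(\<lambda>x. abel_kernel (t - t * x) * abel_kernel (t * x)) =
       (\<lambda>x. complex_of_real ((1 / (pi * t)) * (indicator {0..1} x *\<^sub>R ?f x)))"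
    proof
      fix x
      have 1: "t * x > 0 \<longleftrightarrow> x > 0" "t - t * x > 0 \<longleftrightarrow> x < 1" using t by (auto simp: zero_less_mult_iff)
      show "abel_kernel (t - t * x) * abel_kernel (t * x) =
         complex_of_real ((1 / (pi * t)) * (indicator {0..1} x *\<^sub>R ?f x))"
      proof (cases "0 < x \<and> x < 1")
        case True
        then have x: "0 < x" "x < 1" by auto
        have "sqrt (t - t * x) = sqrt t * sqrt (1 - x)"
          by (subst real_sqrt_mult[symmetric]) (simp add: algebra_simps)
        moreover have "?f x = 1 / (sqrt x * sqrt (1 - x))"
          using x by (simp add: powr_minus powr_half_sqrt field_simps)
        ultimately show ?thesis using x t 1 unfolding abel_kernel_def
          by (simp add: real_sqrt_mult field_simps flip: of_real_mult)
      next
        case False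
        then show ?thesis using 1 by (auto simp: abel_kernel_def indicator_def)
      qed
    qed
    also have "(\<integral>x. complex_of_real ((1 / (pi * t)) * (indicator {0..1} x *\<^sub>R ?f x)) \<partial>lborel)
       = complex_of_real ((1 / (pi * t)) * (LBINT x:{0..1}. ?f x))"
      unfolding integral_complex_of_real set_lebesgue_integral_def by (simp only: integral_mult_right_zero)
    also have "(LBINT x:{0..1}. ?f x) = pi"
      using set_borel_integral_eq_integral(2)[OF si] hi by (simp add: integral_unique)
    finally show ?thesis using t by (simp add: heaviside_def scaleR_conv_of_real flip: of_real_mult)
  qed
  then show ?thesis by (intro eventually_mono[OF AE_lborel_singleton[of 0]])
qed

lemma erfc_derivative: "(erfc has_field_derivative (- 2 / of_real (sqrt pi) * exp (- (z\<^sup>2)))) (at z)"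
proof -
  have h: "(\<lambda>u::complex. exp (- (u\<^sup>2))) holomorphic_on UNIV" by (intro holomorphic_intros)
  have "\<exists>g. \<forall>x::complex. (g has_field_derivative exp (- (x\<^sup>2))) (at x)"
    by (rule holomorphic_convex_primitive'[OF convex_UNIV open_UNIV h]) blast
  then obtain g where g: "\<And>x::complex. (g has_field_derivative exp (- (x\<^sup>2))) (at x)" by blast
  have "((\<lambda>u. exp (- (u\<^sup>2))) has_contour_integral (g (pathfinish (linepath 0 z)) - g (pathstart (linepath 0 z)))) (linepath 0 z)" for z
    by (rule contour_integral_primitive[of UNIV]) (rule g, rule valid_path_linepath, rule subset_UNIV)
  then have "((\<lambda>u. exp (- (u\<^sup>2))) has_contour_integral (g z - g 0)) (linepath 0 z)" for z
    by (simp only: pathfinish_linepath pathstart_linepath)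
  then have "contour_integral (linepath 0 z) (\<lambda>u. exp (- (u\<^sup>2))) = g z - g 0" for z
    by (rule contour_integral_unique)
  then have "erfc = (\<lambda>z. 1 - 2 / of_real (sqrt pi) * (g z - g 0))" by (simp add: erfc_def fun_eq_iff)
  moreover have "((\<lambda>z. 1 - 2 / of_real (sqrt pi) * (g z - g 0)) has_field_derivative
      (- 2 / of_real (sqrt pi) * exp (- (z\<^sup>2)))) (at z)"
    by (auto intro!: derivative_eq_intros g)
  ultimately show ?thesis by simp
qed

lemma erfc_0: "erfc 0 = 1" by (simp add: erfc_def)

lemma erfc_cnj: "erfc (cnj z) = cnj (erfc z)"
proof -
  let ?f = "\<lambda>u. exp (- (u\<^sup>2))"
  have "?f contour_integrable_on (linepath 0 z)"
    by (intro contour_integrable_continuous_linepath continuous_intros)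
  then have "(?f has_contour_integral contour_integral (linepath 0 z) ?f) (linepath 0 z)"
    by (rule has_contour_integral_integral)
  then have "((\<lambda>x. cnj (?f (linepath 0 z x) * (z - 0))) has_integral
     cnj (contour_integral (linepath 0 z) ?f)) {0..1}"
    unfolding has_contour_integral_linepath has_integral_cnj[unfolded o_def] by simp
  then have "(?f has_contour_integral cnj (contour_integral (linepath 0 z) ?f)) (linepath 0 (cnj z))"
    unfolding has_contour_integral_linepath by (simp add: linepath_def exp_cnj scaleR_conv_of_real)
  then have "contour_integral (linepath 0 (cnj z)) ?f = cnj (contour_integral (linepath 0 z) ?f)"
    by (rule contour_integral_unique)
  then show ?thesis by (simp add: erfc_def)
qed

lemma phi_cnj: "phi (cnj r) t = cnj (phi r t)"
proof -
  have "- cnj r * complex_of_real (sqrt t) = cnj (- r * complex_of_real (sqrt t))" by simp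
  then have "erfc (- cnj r * complex_of_real (sqrt t)) = cnj (erfc (- r * complex_of_real (sqrt t)))"
    by (metis erfc_cnj)
  then show ?thesis unfolding phi_def by (simp add: exp_cnj)
qed

lemma phi_regular: "phi r \<in> causal_loc_int" "loc_bounded (phi r)" "AE x in lborel. isCont (phi r) x"
  "continuous_on {0..} (phi r)"
proof -
  have "isCont erfc z" for z using erfc_derivative by (rule DERIV_isCont)
  then have "continuous_on UNIV erfc" by (simp add: continuous_on_eq_continuous_at)
  then have "continuous_on {0..} (\<lambda>t. erfc (- r * of_real (sqrt t)))"
    by (rule continuous_on_compose2) (auto intro!: continuous_intros)
  then have "continuous_on {0..} (\<lambda>t. exp (r\<^sup>2 * of_real t) * erfc (- r * of_real (sqrt t)))"
    by (intro continuous_on_mult) (auto intro!: continuous_intros)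
  from causal_extension[OF this, of "phi r"] show "phi r \<in> causal_loc_int" "loc_bounded (phi r)"
    "AE x in lborel. isCont (phi r) x" "continuous_on {0..} (phi r)" by (auto simp: phi_def)
qed

lemma conv_heaviside:
  assumes "u \<in> causal_loc_int"
  shows "(u has_integral conv heaviside u t) {0..t}"
proof -
  have ex: "conv_exists heaviside u t" by (intro conv_exists_bounded heaviside_regular assms)
  note * = conv_eq_integral[OF heaviside_regular(1) assms ex]
  have "((\<lambda>x. heaviside (t - x) * u x) has_integral conv heaviside u t) {0..t}"
    using *(1) *(2) by (metis has_integral_integral set_lebesgue_integral_eq_integral(1))
  then show ?thesis by (rule has_integral_eq[rotated]) (auto simp: heaviside_def)
qed

text \<open>The integrated form of \<open>phi' = r^2 phi + r / sqrt (pi t)\<close> with \<open>phi 0 = 1\<close>.\<close>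

lemma phi_ode:
  "phi r t = heaviside t + r\<^sup>2 * conv heaviside (phi r) t + r * conv heaviside abel_kernel t"
proof (cases "t \<ge> 0")
  case False
  then show ?thesis using conv_neg[OF heaviside_regular(1) phi_regular(1)[of r]] conv_neg[OF heaviside_regular(1) abel_kernel_loc_int]
    by (simp add: phi_def heaviside_def)
next
  case True
  have deriv: "(phi r has_vector_derivative (r\<^sup>2 * phi r x + r * abel_kernel x)) (at x)" if "x > 0" for x
  proof -
    let ?E = "\<lambda>x. exp (r\<^sup>2 * complex_of_real x)"
    have 0: "((\<lambda>x. complex_of_real (sqrt x)) has_vector_derivative of_real (1 / (2 * sqrt x))) (at x)"
      using that by (intro has_vector_derivative_of_real)
        (auto intro!: derivative_eq_intros simp: field_simps simp flip: has_real_derivative_iff_has_vector_derivative)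
    have "((\<lambda>z. erfc (- r * z)) has_field_derivative
        (- 2 / of_real (sqrt pi) * exp (- ((- r * z)\<^sup>2)) * (- r))) (at z)" for z
      by (rule DERIV_chain2[OF erfc_derivative]) (auto intro!: derivative_eq_intros)
    from field_vector_diff_chain_at[OF 0 this]
    have 1: "((\<lambda>x. erfc (- r * complex_of_real (sqrt x))) has_vector_derivative
       of_real (1 / (2 * sqrt x)) * (- 2 / of_real (sqrt pi) * exp (- ((- r * complex_of_real (sqrt x))\<^sup>2)) * (- r))) (at x)"
      by (simp add: o_def)
    have sq0: "complex_of_real (sqrt x)^2 = of_real x" using that by (simp flip: of_real_power)
    then have sq: "(- r * complex_of_real (sqrt x))\<^sup>2 = r\<^sup>2 * of_real x"
      by (simp add: power_mult_distrib)
    have "((\<lambda>z. exp (r\<^sup>2 * z)) has_field_derivative r\<^sup>2 * ?E x) (at (of_real x))"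
      by (auto intro!: derivative_eq_intros)
    then have 2: "(?E has_vector_derivative (r\<^sup>2 * ?E x)) (at x)" by (rule has_vector_derivative_real_field)
    have "((\<lambda>x. ?E x * erfc (- r * complex_of_real (sqrt x))) has_vector_derivative
       (r\<^sup>2 * phi r x + r * abel_kernel x)) (at x)"
      by (rule has_vector_derivative_eq_rhs[OF has_vector_derivative_mult[OF 2 1]])
         (use that in \<open>simp add: sq sq0 phi_def abel_kernel_def exp_minus field_simps\<close>)
    moreover have "?E y * erfc (- r * complex_of_real (sqrt y)) = phi r y" if "y \<in> {0<..}" for y
      using that by (simp add: phi_def)
    ultimately show ?thesis
      using has_vector_derivative_transform_within_open[OF _ open_greaterThan, of _ _ x 0 "phi r"] that
      by (simp only: greaterThan_iff)
  qed
  have "((\<lambda>x. r\<^sup>2 * phi r x + r * abel_kernel x) has_integral (phi r t - phi r 0)) {0..t}"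
    using True deriv by (intro fundamental_theorem_of_calculus_interior continuous_on_subset[OF phi_regular(4)]) auto
  moreover have "((\<lambda>x. r\<^sup>2 * phi r x + r * abel_kernel x) has_integral
     (r\<^sup>2 * conv heaviside (phi r) t + r * conv heaviside abel_kernel t)) {0..t}"
    by (intro has_integral_add has_integral_mult_right conv_heaviside phi_regular abel_kernel_loc_int)
  ultimately have "phi r t - phi r 0 = r\<^sup>2 * conv heaviside (phi r) t + r * conv heaviside abel_kernel t"
    by (rule has_integral_unique)
  then show ?thesis using True by (simp add: phi_def heaviside_def erfc_0 algebra_simps)
qed

text \<open>\<open>v = conv heaviside u\<close> satisfies \<open>v' = c v\<close> and \<open>v 0 = 0\<close>.\<close>

lemma volterra_exponential_zero:
  assumes u: "u \<in> causal_loc_int" and eq: "\<And>t. u t = c * conv heaviside u t"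
  shows "u t = 0"
proof (cases "t < 0")
  case True
  then show ?thesis using causal_loc_intD(2)[OF u] by simp
next
  case False
  define v where "v = conv heaviside u"
  have "isCont v t" for t unfolding v_def by (intro conv_isCont heaviside_regular u)
  then have cv: "continuous_on S v" for S by (simp add: continuous_at_imp_continuous_on)
  have ueq: "u = (\<lambda>t. c * v t)" using eq by (simp add: v_def fun_eq_iff)
  have cu: "continuous_on S u" for S unfolding ueq by (intro continuous_intros cv)
  have v_int: "v s = integral {0..s} u" for s
    using conv_heaviside[OF u] unfolding v_def by (rule integral_unique[symmetric])
  have d: "(v has_vector_derivative c * v s) (at s within {0..t})" if "s \<in> {0..t}" for s
    using integral_has_vector_derivative[OF cu that] unfolding v_int[symmetric] by (simp add: ueq)
  have "((\<lambda>s. exp (- c * of_real s) * v s) has_vector_derivative 0) (at s within {0..t})" if "s \<in> {0..t}" for s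
  proof -
    have "((\<lambda>z. exp (- c * z)) has_field_derivative (- c * exp (- c * of_real s))) (at (of_real s))"
      by (auto intro!: derivative_eq_intros)
    then have "((\<lambda>s. exp (- c * of_real s)) has_vector_derivative (- c * exp (- c * of_real s))) (at s within {0..t})"
      by (rule has_vector_derivative_real_field)
    from has_vector_derivative_mult[OF this d[OF that]] show ?thesis by (simp add: algebra_simps)
  qed
  then have "\<forall>s\<in>{0..t}. ((\<lambda>s. exp (- c * of_real s) * v s) has_derivative (\<lambda>h. 0)) (at s within {0..t})"
    by (auto simp: has_vector_derivative_def)
  from has_derivative_zero_constant[OF convex_real_interval(5) this[rule_format]]
  obtain C where C: "\<And>s. s \<in> {0..t} \<Longrightarrow> exp (- c * of_real s) * v s = C" by blast
  have "exp (- c * of_real t) * v t = exp (- c * of_real 0) * v 0"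
    using C[of 0] C[of t] False by simp
  also have "v 0 = 0" by (simp add: v_int)
  finally show ?thesis by (simp add: ueq)
qed

text \<open>The relation \<open>phi = 1 + r J phi\<close>. By \<open>phi_ode\<close> the function \<open>phi\<close> satisfies
  \<open>(1 - r^2 J^2) phi = (1 + r J) 1\<close>, that is, \<open>(1 + r J)\<close> annihilates
  \<open>u = (1 - r J) phi - 1\<close>. Applying \<open>(1 - r J)\<close> once more gives \<open>u = r^2 J^2 u\<close>, an
  integral equation without a singular kernel, and so \<open>u = 0\<close>.\<close>

lemma conv_abel_phi: "r * conv abel_kernel (phi r) t = phi r t - heaviside t"
proof (cases "r = 0")
  case True
  then show ?thesis by (simp add: phi_def heaviside_def erfc_0)
next
  case False
  note [simp] = heaviside_regular(1) phi_regular(1) abel_kernel_loc_int conv_loc_int(2)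
  let ?H = heaviside and ?k = abel_kernel
  have exH: "conv_exists ?H w t" if "w \<in> causal_loc_int" for w t
    by (rule conv_exists_bounded[OF heaviside_regular(1) that heaviside_regular(2)])
  have exk: "conv_exists ?k (phi r) t" "conv_exists ?k ?H t" for t
    using conv_exists_bounded[OF phi_regular(1) abel_kernel_loc_int phi_regular(2), of r t] exH[OF abel_kernel_loc_int, of t]
    by (simp_all add: conv_exists_commute)
  have Hk: "conv ?k ?H = conv ?H ?k" by (auto simp: conv_commute)
  have "isCont (conv ?H ?k) t" for t by (intro conv_isCont heaviside_regular abel_kernel_loc_int)
  then have "continuous_on {0..} (conv ?H ?k)" by (simp add: continuous_at_imp_continuous_on)
  then have "loc_bounded (conv ?H ?k)"
    by (rule causal_extension) (use conv_neg[of ?H ?k] in auto)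
  then have exk2: "conv_exists ?k (conv ?H ?k) t" for t
    using conv_exists_bounded[of "conv ?H ?k" ?k t] by (simp add: conv_exists_commute)
  define u where "u = (\<lambda>t. phi r t + (- r) * conv ?k (phi r) t + (- 1) * ?H t)"
  have u: "u \<in> causal_loc_int"
    unfolding u_def by (intro causal_loc_int_add causal_loc_int_scale) auto
  \<comment> \<open>The kernels of \<open>J J\<close> and of integration agree only almost everywhere; one more integration
    makes this a pointwise identity.\<close>
  have kk: "conv ?H (conv ?k ?k) = conv ?H ?H"
    by (rule ext, rule conv_cong_AE[OF _ conv_abel_abel]) (auto intro: causal_loc_intD)
  have "u t = r\<^sup>2 * conv ?H u t" for t
  proof -
    have "conv ?H u t = conv ?H (phi r) t + (- r) * conv ?H (conv ?k (phi r)) t + (- 1) * conv ?H ?H t"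
      unfolding u_def
      by (simp only: conv_add_right conv_scale_right exH causal_loc_int_scale causal_loc_int_add
          heaviside_regular(1) phi_regular(1) abel_kernel_loc_int conv_loc_int(2))
    moreover have "conv ?H (conv ?k (phi r)) t = conv ?k (conv ?H (phi r)) t"
      using conv_assoc_bounded[of ?H "phi r" ?k] heaviside_regular(2)
      by (simp add: conv_commute[of ?k "phi r", THEN ext] conv_commute[of ?k])
    moreover have "conv ?H (phi r) = (\<lambda>t. inverse (r\<^sup>2) * phi r t + ((- inverse (r\<^sup>2)) * ?H t + (- inverse r) * conv ?H ?k t))"
      using phi_ode[of r] False by (auto simp: fun_eq_iff field_simps power2_eq_square)
    moreover have "conv ?k (conv ?H ?k) t = conv ?H ?H t"
      using conv_assoc_bounded[of ?H ?k ?k t] heaviside_regular(2) kk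
      by (simp add: conv_commute[of ?k])
    moreover have "conv ?k (\<lambda>t. inverse (r\<^sup>2) * phi r t + ((- inverse (r\<^sup>2)) * ?H t + (- inverse r) * conv ?H ?k t)) t
       = inverse (r\<^sup>2) * conv ?k (phi r) t + ((- inverse (r\<^sup>2)) * conv ?k ?H t + (- inverse r) * conv ?k (conv ?H ?k) t)"
    proof -
      have "conv_exists ?k (\<lambda>t. (- inverse (r\<^sup>2)) * ?H t + (- inverse r) * conv ?H ?k t) t"
        "conv_exists ?k (\<lambda>t. inverse (r\<^sup>2) * phi r t) t"
        "conv_exists ?k (\<lambda>t. (- inverse (r\<^sup>2)) * ?H t) t" "conv_exists ?k (\<lambda>t. (- inverse r) * conv ?H ?k t) t"
        unfolding conv_exists_commute[of ?k]
        by (intro conv_exists_add_left conv_exists_scale_left exk[unfolded conv_exists_commute[of ?k]]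
          exk2[unfolded conv_exists_commute[of ?k]])+
      then show ?thesis by (simp only: conv_add_right conv_scale_right)
    qed
    moreover have "conv ?k ?H t = conv ?H ?k t" by (simp add: conv_commute)
    ultimately have A: "conv ?H u t = conv ?H (phi r) t - r * (inverse (r\<^sup>2) * conv ?k (phi r) t
       + ((- inverse (r\<^sup>2)) * conv ?H ?k t + (- inverse r) * conv ?H ?H t)) - conv ?H ?H t"
      by simp
    have "r\<^sup>2 * conv ?H u t = r\<^sup>2 * conv ?H (phi r) t - r * conv ?k (phi r) t + r * conv ?H ?k t"
      unfolding A using False by (simp add: field_simps power2_eq_square)
    also have "\<dots> = u t" unfolding u_def using phi_ode[of r t] by (simp add: algebra_simps)
    finally show ?thesis ..
  qed
  from volterra_exponential_zero[OF u this] show ?thesis by (auto simp: u_def algebra_simps)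
qed

lemma conv_heaviside_phi:
  assumes "r \<noteq> 0"
  shows "conv heaviside (phi r) t = (phi r t - heaviside t - r * conv heaviside abel_kernel t) / r\<^sup>2"
  using phi_ode[of r t] assms by (simp add: field_simps)

lemma conv_exists_heaviside: "w \<in> causal_loc_int \<Longrightarrow> conv_exists heaviside w t"
  by (rule conv_exists_bounded[OF heaviside_regular(1) _ heaviside_regular(2)])

lemma conv_heaviside_heaviside: "t \<ge> 0 \<Longrightarrow> conv heaviside heaviside t = of_real t"
proof -
  assume t: "t \<ge> 0"
  have "((\<lambda>x. 1 :: complex) has_integral of_real t) {0..t}"
    using has_integral_const_real[of "1::complex" 0 t] t by (simp add: scaleR_conv_of_real)
  then have "(heaviside has_integral of_real t) {0..t}"
    by (rule has_integral_eq[rotated]) (simp add: heaviside_def)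
  then show ?thesis using conv_heaviside[OF heaviside_regular(1)] by (rule has_integral_unique[rotated])
qed

text \<open>\<open>conv heaviside heaviside\<close> is the function \<open>t\<close>, the kernel of \<open>J^4\<close>.\<close>

lemma ramp_bounded: "loc_bounded (conv heaviside heaviside)"
proof -
  have "continuous_on {0..} (\<lambda>t. complex_of_real t)" by (intro continuous_intros)
  then have "continuous_on {0..} (conv heaviside heaviside)"
    by (rule continuous_on_eq) (auto simp: conv_heaviside_heaviside)
  then show ?thesis
    by (rule causal_extension) (use conv_neg[of heaviside heaviside] heaviside_regular in auto)
qed

section \<open>Partial fractions over the roots of the characteristic polynomial\<close>

text \<open>Written over the Vandermonde determinant, the divided difference becomes a polynomial identity.\<close>

lemma third_divided_difference:
  fixes x y z w :: complex
  assumes "x \<noteq> y" "x \<noteq> z" "x \<noteq> w" "y \<noteq> z" "y \<noteq> w" "z \<noteq> w"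
  shows "p/((x-y)*(x-z)*(x-w)) + q/((y-x)*(y-z)*(y-w)) + s/((z-x)*(z-y)*(z-w)) + t/((w-x)*(w-y)*(w-z))
    = (p*(y-z)*(y-w)*(z-w) - q*(x-z)*(x-w)*(z-w) + s*(x-y)*(x-w)*(y-w) - t*(x-y)*(x-z)*(y-z)) /
      ((x-y)*(x-z)*(x-w)*(y-z)*(y-w)*(z-w))"
proof -
  have nz: "x-y \<noteq> 0" "x-z\<noteq>0" "x-w\<noteq>0" "y-z\<noteq>0" "y-w\<noteq>0" "z-w\<noteq>0"
     "y-x \<noteq> 0" "z-x\<noteq>0" "w-x\<noteq>0" "z-y\<noteq>0" "w-y\<noteq>0" "w-z\<noteq>0" using assms by auto
  let ?D = "(x-y)*(x-z)*(x-w)*(y-z)*(y-w)*(z-w)"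
  have "p/((x-y)*(x-z)*(x-w)) = p*(y-z)*(y-w)*(z-w) / ?D" using nz by (simp add: frac_eq_eq)
  moreover have "q/((y-x)*(y-z)*(y-w)) = - (q*(x-z)*(x-w)*(z-w)) / ?D"
    using nz by (subst frac_eq_eq) (simp, simp, simp add: algebra_simps)
  moreover have "s/((z-x)*(z-y)*(z-w)) = s*(x-y)*(x-w)*(y-w) / ?D"
    using nz by (subst frac_eq_eq) (simp, simp, simp add: algebra_simps)
  moreover have "t/((w-x)*(w-y)*(w-z)) = - (t*(x-y)*(x-z)*(y-z)) / ?D"
    using nz by (subst frac_eq_eq) (simp, simp, simp add: algebra_simps)
  ultimately show ?thesis by (simp add: add_divide_distrib diff_divide_distrib)
qed

text \<open>A third divided difference annihilates quadratic polynomials.\<close>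

lemma third_divided_difference_power:
  fixes x y z w :: complex
  assumes "x \<noteq> y" "x \<noteq> z" "x \<noteq> w" "y \<noteq> z" "y \<noteq> w" "z \<noteq> w" and "n \<le> 3"
  shows "x^n/((x-y)*(x-z)*(x-w)) + y^n/((y-x)*(y-z)*(y-w)) + z^n/((z-x)*(z-y)*(z-w)) + w^n/((w-x)*(w-y)*(w-z))
     = (if n = 3 then 1 else 0)"
proof -
  from \<open>n \<le> 3\<close> consider "n = 0" | "n = 1" | "n = 2" | "n = 3" by linarith
  then show ?thesis unfolding third_divided_difference[OF assms(1-6)]
  proof cases
    case 4
    have *: "x^3*(y-z)*(y-w)*(z-w) - y^3*(x-z)*(x-w)*(z-w) + z^3*(x-y)*(x-w)*(y-w) - w^3*(x-y)*(x-z)*(y-z)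
      = (x-y)*(x-z)*(x-w)*(y-z)*(y-w)*(z-w)" by (simp add: algebra_simps power2_eq_square power3_eq_cube)
    show "(x ^ n * (y - z) * (y - w) * (z - w) - y ^ n * (x - z) * (x - w) * (z - w) +
     z ^ n * (x - y) * (x - w) * (y - w) - w ^ n * (x - y) * (x - z) * (y - z)) /
      ((x-y)*(x-z)*(x-w)*(y-z)*(y-w)*(z-w)) = (if n = 3 then 1 else 0)"
      unfolding 4 * using assms by simp
  qed (simp_all add: algebra_simps power2_eq_square)
qed

locale bagley_torvik =
  fixes a b c :: real and r :: "nat \<Rightarrow> complex"
  assumes a_nz: "a \<noteq> 0" and roots: "bij_betw r {1..4} {z. bt_poly a b c z = 0}"
begin

lemma root_eq: "j \<in> {1..4} \<Longrightarrow> of_real a * r j ^ 4 + of_real b * r j ^ 3 + of_real c = 0"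
  using bij_betwE[OF roots] by (auto simp: bt_poly_def)

lemma root_inj: "i \<in> {1..4} \<Longrightarrow> j \<in> {1..4} \<Longrightarrow> r i = r j \<longleftrightarrow> i = j"
  using roots by (auto simp: bij_betw_def inj_on_def)

lemma c_nz: "c \<noteq> 0"
proof
  assume "c = 0"
  then have "{z. bt_poly a b c z = 0} \<subseteq> {0, - of_real b / of_real a}"
  proof (intro subsetI)
    fix z assume z: "z \<in> {z. bt_poly a b c z = 0}"
    have "z ^ 3 * (of_real a * z + of_real b) = 0"
      using z \<open>c = 0\<close> by (simp add: bt_poly_def algebra_simps power_numeral_reduce)
    then have "z = 0 \<or> of_real a * z = - of_real b" by (auto simp: add_eq_0_iff2)
    then show "z \<in> {0, - of_real b / of_real a}" using a_nz by (auto simp: field_simps)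
  qed
  then have "card {z. bt_poly a b c z = 0} \<le> card {0, - complex_of_real b / of_real a}"
    by (rule card_mono[rotated]) auto
  also have "\<dots> \<le> 2" by (simp add: card_insert_if)
  finally show False using bij_betw_same_card[OF roots] by simp
qed

lemma root_nz: "j \<in> {1..4} \<Longrightarrow> r j \<noteq> 0"
  using root_eq[of j] c_nz by auto

lemma bt_poly_factored:
  "bt_poly a b c z = of_real a * ((z - r 1) * (z - r 2) * (z - r 3) * (z - r 4))"
proof -
  define p where "p = [:of_real c, 0, 0, of_real b, complex_of_real a:]"
  define q where "q = smult (of_real a) ([:- r 1, 1:] * [:- r 2, 1:] * [:- r 3, 1:] * [:- r 4, 1:])"
  have "p = q"
  proof (rule poly_eqI_degree_lead_coeff[where n = 4 and A = "r ` {1..4}"])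
    show "card (r ` {1..4}) \<ge> 4"
      using bij_betw_imp_inj_on[OF roots] by (simp add: card_image)
    show "poly p z = poly q z" if "z \<in> r ` {1..4}" for z
    proof -
      from that obtain j where j: "j \<in> {1..4}" "z = r j" by auto
      then have "j = 1 \<or> j = 2 \<or> j = 3 \<or> j = 4" by auto
      moreover have lin: "poly [:- u, 1:] z = z - u" for u by simp
      have "poly q z = of_real a * ((z - r 1) * (z - r 2) * (z - r 3) * (z - r 4))"
        unfolding q_def poly_smult poly_mult lin ..
      ultimately have "poly q z = 0" using j(2) by auto
      moreover have "poly p z = 0"
        using root_eq[OF j(1)] by (simp add: p_def j(2) algebra_simps power_numeral_reduce)
      ultimately show ?thesis by simp
    qed
    show "degree p \<le> 4" by (simp add: p_def a_nz)
    show "degree q \<le> 4" by (simp add: q_def a_nz)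
    show "coeff p 4 = coeff q 4" by (simp add: p_def q_def numeral_eq_Suc)
  qed
  then have "poly p z = poly q z" by simp
  then show ?thesis by (simp add: p_def q_def bt_poly_def algebra_simps power_numeral_reduce)
qed

lemma bt_poly_deriv_root:
  assumes ijkl: "{i, j, k, l} = {1..4::nat}"
  shows "of_real a * ((r i - r j) * (r i - r k) * (r i - r l)) = (r i)\<^sup>2 * (4 * of_real a * r i + 3 * of_real b)"
proof -
  have d1: "(bt_poly a b c has_field_derivative (r i)\<^sup>2 * (4 * of_real a * r i + 3 * of_real b)) (at (r i))"
    unfolding bt_poly_def[abs_def] by (auto intro!: derivative_eq_intros simp: algebra_simps power_numeral_reduce)
  have "card {i, j, k, l} = 4" using ijkl by simp
  then have "distinct [i, j, k, l]" by (intro card_distinct) simp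
  have "bt_poly a b c = (\<lambda>z. of_real a * (\<Prod>m\<in>{1..4}. z - r m))"
    by (auto simp: bt_poly_factored numeral_eq_Suc prod.atLeast_Suc_atMost algebra_simps)
  also have "\<dots> = (\<lambda>z. of_real a * ((z - r i) * (z - r j) * (z - r k) * (z - r l)))"
    unfolding ijkl[symmetric] using \<open>distinct [i, j, k, l]\<close> by (auto simp: algebra_simps)
  finally have "bt_poly a b c = (\<lambda>z. of_real a * ((z - r i) * (z - r j) * (z - r k) * (z - r l)))" .
  then have "(bt_poly a b c has_field_derivative of_real a * ((r i - r j) * (r i - r k) * (r i - r l))) (at (r i))"
    by (auto intro!: derivative_eq_intros simp: algebra_simps)
  from DERIV_unique[OF this d1] show ?thesis .
qed

text \<open>These are the coefficients \<open>r / P'(r)\<close> of the Green function, where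
  \<open>P'(r) = r^2 (4 a r + 3 b)\<close>.\<close>

definition weight :: "nat \<Rightarrow> complex" where
  "weight j = 1 / ((4 * of_real a * r j + 3 * of_real b) * r j)"

lemma weight_moment:
  assumes "n \<le> 3"
  shows "(\<Sum>j=1..4. weight j * r j ^ n / r j) = (if n = 3 then 1 / of_real a else 0)"
proof -
  have S: "{1..4::nat} = {1,2,3,4}" by auto
  have S2: "{2,1,3,4} = {1..4::nat}" and S3: "{3,1,2,4} = {1..4::nat}" and S4: "{4,1,2,3} = {1..4::nat}" by auto
  have w: "weight i * r i ^ n / r i = r i ^ n / ((r i - r j) * (r i - r k) * (r i - r l)) / of_real a"
    if "{i, j, k, l} = {1..4::nat}" for i j k l
  proof -
    have "weight i * r i ^ n / r i = r i ^ n / ((r i)\<^sup>2 * (4 * of_real a * r i + 3 * of_real b))"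
      by (simp add: weight_def power2_eq_square mult_ac)
    then show ?thesis unfolding bt_poly_deriv_root[OF that, symmetric] by (simp add: mult_ac)
  qed
  have "(\<Sum>j=1..4. weight j * r j ^ n / r j) =
     (r 1 ^ n / ((r 1 - r 2) * (r 1 - r 3) * (r 1 - r 4)) +
      r 2 ^ n / ((r 2 - r 1) * (r 2 - r 3) * (r 2 - r 4)) +
      r 3 ^ n / ((r 3 - r 1) * (r 3 - r 2) * (r 3 - r 4)) +
      r 4 ^ n / ((r 4 - r 1) * (r 4 - r 2) * (r 4 - r 3))) / of_real a"
    unfolding add_divide_distrib
      w[of 1 2 3 4, OF S[symmetric], symmetric] w[of 2 1 3 4, OF S2, symmetric]
      w[of 3 1 2 4, OF S3, symmetric] w[of 4 1 2 3, OF S4, symmetric]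
    unfolding S by (simp add: add.assoc)
  also have "\<dots> = (if n = 3 then 1 else 0) / of_real a"
    by (subst third_divided_difference_power) (use root_inj assms in auto)
  finally show ?thesis by auto
qed

text \<open>The moments of order \<open>-1\<close> to \<open>2\<close> are divided differences of powers. The others follow from them by
  \<open>a r^4 + b r^3 + c = 0\<close>, which raises or lowers the exponents.\<close>

lemma weight_moments:
  "(\<Sum>j=1..4. weight j) = 0" "(\<Sum>j=1..4. weight j * r j) = 0" "(\<Sum>j=1..4. weight j * r j ^ 2) = 1 / of_real a"
  "(\<Sum>j=1..4. weight j * r j ^ 3) = - of_real b / (of_real a)\<^sup>2"
  "(\<Sum>j=1..4. weight j / r j) = 0" "(\<Sum>j=1..4. weight j / r j ^ 2) = - 1 / of_real c"
  "(\<Sum>j=1..4. weight j / r j ^ 3) = 0" "(\<Sum>j=1..4. weight j / r j ^ 4) = 0"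
proof -
  have nz: "r j \<noteq> 0" if "j \<in> {1..4}" for j using root_nz that .
  show m1: "(\<Sum>j=1..4. weight j / r j) = 0" using weight_moment[of 0] by simp
  have "(\<Sum>j=1..4. weight j) = (\<Sum>j=1..4. weight j * r j ^ 1 / r j)" by (intro sum.cong) (auto simp: nz)
  then show m2: "(\<Sum>j=1..4. weight j) = 0" using weight_moment[of 1] by simp
  have "(\<Sum>j=1..4. weight j * r j) = (\<Sum>j=1..4. weight j * r j ^ 2 / r j)"
    by (intro sum.cong) (auto simp: nz power2_eq_square)
  then show m3: "(\<Sum>j=1..4. weight j * r j) = 0" using weight_moment[of 2] by simp
  have "(\<Sum>j=1..4. weight j * r j ^ 2) = (\<Sum>j=1..4. weight j * r j ^ 3 / r j)"
    by (intro sum.cong) (auto simp: nz power2_eq_square power3_eq_cube)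
  then show m4: "(\<Sum>j=1..4. weight j * r j ^ 2) = 1 / of_real a" using weight_moment[of 3] by simp
  have an: "complex_of_real a \<noteq> 0" "complex_of_real c \<noteq> 0" using a_nz c_nz by auto
  have top: "of_real a * r j ^ 4 = - of_real b * r j ^ 3 - of_real c" if "j \<in> {1..4}" for j
    using root_eq[OF that] by (simp add: algebra_simps eq_neg_iff_add_eq_0)
  have "of_real a * (\<Sum>j=1..4. weight j * r j ^ 3) = (\<Sum>j=1..4. - of_real b * (weight j * r j ^ 2) - of_real c * (weight j / r j))"
    unfolding sum_distrib_left
  proof (intro sum.cong refl)
    fix j :: nat assume j: "j \<in> {1..4}"
    have "of_real a * (weight j * r j ^ 3) = weight j * (of_real a * r j ^ 4) / r j"
      using nz[OF j] by (simp add: power_numeral_reduce)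
    then show "of_real a * (weight j * r j ^ 3) = - of_real b * (weight j * r j ^ 2) - of_real c * (weight j / r j)"
      unfolding top[OF j] using nz[OF j] by (simp add: field_simps power_numeral_reduce)
  qed
  also have "\<dots> = - of_real b / of_real a"
    unfolding sum_subtractf sum_distrib_left[symmetric] m4 m1 by simp
  finally show "(\<Sum>j=1..4. weight j * r j ^ 3) = - of_real b / (of_real a)\<^sup>2"
    using an by (simp add: field_simps power2_eq_square)
  have low: "of_real c = - of_real a * r j ^ 4 - of_real b * r j ^ 3" if "j \<in> {1..4}" for j
    using root_eq[OF that] by (simp add: algebra_simps eq_neg_iff_add_eq_0)
  have "of_real c * (\<Sum>j=1..4. weight j / r j ^ 2) = (\<Sum>j=1..4. - of_real a * (weight j * r j ^ 2) - of_real b * (weight j * r j))"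
    unfolding sum_distrib_left
    by (intro sum.cong refl, subst low) (auto simp: nz field_simps power_numeral_reduce)
  then have "of_real c * (\<Sum>j=1..4. weight j / r j ^ 2) = - 1"
    unfolding sum_subtractf sum_distrib_left[symmetric] m4 m3 using an by simp
  then show "(\<Sum>j=1..4. weight j / r j ^ 2) = - 1 / of_real c" using an by (simp add: field_simps)
  have "of_real c * (\<Sum>j=1..4. weight j / r j ^ 3) = (\<Sum>j=1..4. - of_real a * (weight j * r j) - of_real b * weight j)"
    unfolding sum_distrib_left
    by (intro sum.cong refl, subst low) (auto simp: nz field_simps power_numeral_reduce)
  then show "(\<Sum>j=1..4. weight j / r j ^ 3) = 0"
    unfolding sum_subtractf sum_distrib_left[symmetric] m2 m3 using an by simp
  have "of_real c * (\<Sum>j=1..4. weight j / r j ^ 4) = (\<Sum>j=1..4. - of_real a * weight j - of_real b * (weight j / r j))"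
    unfolding sum_distrib_left
    by (intro sum.cong refl, subst low) (auto simp: nz field_simps power_numeral_reduce)
  then show "(\<Sum>j=1..4. weight j / r j ^ 4) = 0"
    unfolding sum_subtractf sum_distrib_left[symmetric] m2 m1 using an by simp
qed

section \<open>The resolvent kernel\<close>

text \<open>The kernel of \<open>(b/a) J + (c/a) J^4\<close>.\<close>

definition volterra_kernel :: "real \<Rightarrow> complex" where
  "volterra_kernel t = of_real (b / a) * abel_kernel t + of_real (c / a) * conv heaviside heaviside t"

text \<open>For \<open>t > 0\<close> this is \<open>a G'' t\<close> for the Green function \<open>G\<close>. The Abel term appears because
  \<open>phi'\<close> contains \<open>r / sqrt (pi t)\<close>, and its coefficient is a moment of the weights.\<close>

definition resolvent :: "real \<Rightarrow> complex" where
  "resolvent t = (\<Sum>j=1..4. (of_real a * weight j * r j ^ 4) * phi (r j) t) + (- of_real (b / a)) * abel_kernel t"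

text \<open>The function with Laplace transform \<open>1 / (a s^2 + b s^(3/2) + c) = 1 / P(sqrt s)\<close>.\<close>

definition green :: "real \<Rightarrow> complex" where
  "green t = (\<Sum>j=1..4. weight j * phi (r j) t)"

lemma phi_sum_loc_int: "(\<lambda>t. \<Sum>j=1..4. d j * phi (r j) t) \<in> causal_loc_int"
  by (intro causal_loc_int_sum phi_regular)

lemma volterra_kernel_loc_int: "volterra_kernel \<in> causal_loc_int"
  unfolding volterra_kernel_def[abs_def]
  by (intro causal_loc_int_add causal_loc_int_scale conv_loc_int abel_kernel_loc_int heaviside_regular)

lemma resolvent_loc_int: "resolvent \<in> causal_loc_int"
  unfolding resolvent_def[abs_def] by (intro causal_loc_int_add causal_loc_int_scale phi_sum_loc_int abel_kernel_loc_int)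

lemma green_loc_int: "green \<in> causal_loc_int"
  unfolding green_def[abs_def] by (rule phi_sum_loc_int)

lemma conv_heaviside_phi_sum:
  "conv heaviside (\<lambda>t. \<Sum>j=1..4. d j * phi (r j) t) t =
     (\<Sum>j=1..4. (d j / r j ^ 2) * phi (r j) t) - (\<Sum>j=1..4. d j / r j ^ 2) * heaviside t
       - (\<Sum>j=1..4. d j / r j) * conv heaviside abel_kernel t"
proof -
  have "conv heaviside (\<lambda>t. \<Sum>j=1..4. d j * phi (r j) t) t = (\<Sum>j=1..4. d j * conv heaviside (phi (r j)) t)"
    unfolding conv_commute[of heaviside]
    by (rule conv_sum_left) (simp add: conv_exists_commute[of _ heaviside] conv_exists_heaviside phi_regular)
  also have "\<dots> = (\<Sum>j=1..4. (d j / r j ^ 2) * phi (r j) t - (d j / r j ^ 2) * heaviside t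
       - (d j / r j) * conv heaviside abel_kernel t)"
    by (intro sum.cong refl, subst conv_heaviside_phi) (auto simp: root_nz field_simps power2_eq_square)
  finally show ?thesis by (simp add: sum_subtractf sum_distrib_right)
qed

lemma conv_heaviside_resolvent:
  "conv heaviside resolvent t = (\<Sum>j=1..4. (of_real a * (weight j * r j ^ 2)) * phi (r j) t) - heaviside t"
proof -
  have e: "conv heaviside resolvent t = conv heaviside (\<lambda>t. \<Sum>j=1..4. (of_real a * weight j * r j ^ 4) * phi (r j) t) t
      + (- of_real (b / a)) * conv heaviside abel_kernel t"
    unfolding resolvent_def[abs_def]
    by (simp only: conv_add_right conv_scale_right conv_exists_heaviside phi_sum_loc_int abel_kernel_loc_int causal_loc_int_scale)
  have s1: "(\<Sum>j=1..4. of_real a * weight j * r j ^ 4 / r j ^ 2) = of_real a * (\<Sum>j=1..4. weight j * r j ^ 2)"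
    unfolding sum_distrib_left by (intro sum.cong) (auto simp: root_nz field_simps power_numeral_reduce)
  have s2: "(\<Sum>j=1..4. of_real a * weight j * r j ^ 4 / r j) = of_real a * (\<Sum>j=1..4. weight j * r j ^ 3)"
    unfolding sum_distrib_left by (intro sum.cong) (auto simp: root_nz field_simps power_numeral_reduce)
  have s3: "(\<Sum>j=1..4. (of_real a * weight j * r j ^ 4 / r j ^ 2) * phi (r j) t)
      = (\<Sum>j=1..4. (of_real a * (weight j * r j ^ 2)) * phi (r j) t)"
    by (intro sum.cong) (auto simp: root_nz field_simps power_numeral_reduce)
  show ?thesis unfolding e conv_heaviside_phi_sum s1 s2 s3 weight_moments using a_nz
    by (simp add: field_simps power2_eq_square)
qed

text \<open>So \<open>a G = J^4 (\<delta> + resolvent)\<close>: applying the double integral to the solution of the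
  Volterra equation yields a convolution with the Green function.\<close>

lemma conv_heaviside_heaviside_resolvent:
  "conv heaviside (conv heaviside resolvent) t = of_real a * green t - conv heaviside heaviside t"
proof -
  have eq: "conv heaviside resolvent =
      (\<lambda>t. (\<Sum>j=1..4. (of_real a * (weight j * r j ^ 2)) * phi (r j) t) + (- 1) * heaviside t)"
    by (simp add: conv_heaviside_resolvent fun_eq_iff)
  have e: "conv heaviside (conv heaviside resolvent) t
      = conv heaviside (\<lambda>t. \<Sum>j=1..4. (of_real a * (weight j * r j ^ 2)) * phi (r j) t) t
        + (- 1) * conv heaviside heaviside t"
    unfolding eq
    by (simp only: conv_add_right conv_scale_right conv_exists_heaviside phi_sum_loc_int heaviside_regular causal_loc_int_scale)
  have s1: "(\<Sum>j=1..4. of_real a * (weight j * r j ^ 2) / r j ^ 2) = of_real a * (\<Sum>j=1..4. weight j)"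
    unfolding sum_distrib_left by (intro sum.cong) (auto simp: root_nz field_simps power_numeral_reduce)
  have s2: "(\<Sum>j=1..4. of_real a * (weight j * r j ^ 2) / r j) = of_real a * (\<Sum>j=1..4. weight j * r j)"
    unfolding sum_distrib_left by (intro sum.cong) (auto simp: root_nz field_simps power_numeral_reduce)
  have s3: "(\<Sum>j=1..4. (of_real a * (weight j * r j ^ 2) / r j ^ 2) * phi (r j) t) = of_real a * green t"
    unfolding green_def sum_distrib_left
    by (intro sum.cong) (auto simp: root_nz field_simps power_numeral_reduce)
  show ?thesis unfolding e conv_heaviside_phi_sum s1 s2 s3 weight_moments by simp
qed

text \<open>Every convolution on the left is an explicit combination of the functions \<open>phi\<close>, the Abel
  kernel and powers of \<open>t\<close>. The coefficient of \<open>phi (r j)\<close> is proportional to \<open>P (r j)\<close>, and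
  the other coefficients cancel by the moment identities.\<close>

lemma resolvent_equation: "AE t in lborel. volterra_kernel t + resolvent t + conv volterra_kernel resolvent t = 0"
  using conv_loc_int(1)[OF abel_kernel_loc_int resolvent_loc_int] conv_loc_int(1)[OF conv_loc_int(2)[OF heaviside_regular(1) heaviside_regular(1)] resolvent_loc_int]
    conv_loc_int(1)[OF abel_kernel_loc_int abel_kernel_loc_int] conv_abel_abel
proof eventually_elim
  case (elim t)
  have exk: "conv_exists (phi (r j)) abel_kernel t" for j
    by (intro conv_exists_bounded phi_regular abel_kernel_loc_int)
  have ab: "of_real a \<noteq> (0 :: complex)" using a_nz by simp
  have "conv volterra_kernel resolvent t = of_real (b / a) * conv abel_kernel resolvent t
     + of_real (c / a) * conv (conv heaviside heaviside) resolvent t"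
    unfolding volterra_kernel_def[abs_def] using elim(1,2) by (simp only: conv_add_left conv_scale_left conv_exists_scale_left)
  also have "conv (conv heaviside heaviside) resolvent t = of_real a * green t - conv heaviside heaviside t"
    using conv_assoc_bounded[OF heaviside_regular(1) heaviside_regular(1) resolvent_loc_int heaviside_regular(2), of t]
    by (simp add: conv_heaviside_heaviside_resolvent)
  also have "conv abel_kernel resolvent t = conv resolvent abel_kernel t" by (rule conv_commute)
  also have "\<dots> = (\<Sum>j=1..4. (of_real a * weight j * r j ^ 4) * conv (phi (r j)) abel_kernel t)
      + (- of_real (b / a)) * conv abel_kernel abel_kernel t"
    unfolding resolvent_def[abs_def] using elim(3) exk
    by (simp only: conv_add_left conv_scale_left conv_exists_scale_left conv_exists_sum_left conv_sum_left)
  also have "(\<Sum>j=1..4. (of_real a * weight j * r j ^ 4) * conv (phi (r j)) abel_kernel t)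
     = (\<Sum>j=1..4. of_real a * (weight j * r j ^ 3 * phi (r j) t) - of_real a * (weight j * r j ^ 3) * heaviside t)"
  proof (intro sum.cong refl)
    fix j :: nat assume "j \<in> {1..4}"
    have "(of_real a * weight j * r j ^ 4) * conv (phi (r j)) abel_kernel t
      = of_real a * weight j * r j ^ 3 * (r j * conv abel_kernel (phi (r j)) t)"
      by (simp add: conv_commute[of abel_kernel] power_numeral_reduce)
    then show "(of_real a * weight j * r j ^ 4) * conv (phi (r j)) abel_kernel t
      = of_real a * (weight j * r j ^ 3 * phi (r j) t) - of_real a * (weight j * r j ^ 3) * heaviside t"
      unfolding conv_abel_phi by (simp add: algebra_simps)
  qed
  also have "\<dots> = of_real a * (\<Sum>j=1..4. weight j * r j ^ 3 * phi (r j) t) - of_real a * (\<Sum>j=1..4. weight j * r j ^ 3) * heaviside t"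
    by (simp add: sum_subtractf sum_distrib_left sum_distrib_right)
  finally have K: "conv volterra_kernel resolvent t = of_real b * (\<Sum>j=1..4. weight j * r j ^ 3 * phi (r j) t)
     + of_real c * green t - of_real (c / a) * conv heaviside heaviside t"
    unfolding weight_moments elim(4) using ab by (simp add: field_simps power2_eq_square)
  have "of_real b * (\<Sum>j=1..4. weight j * r j ^ 3 * phi (r j) t) + of_real c * green t
      + (\<Sum>j=1..4. (of_real a * weight j * r j ^ 4) * phi (r j) t)
      = (\<Sum>j=1..4. weight j * phi (r j) t * (of_real a * r j ^ 4 + of_real b * r j ^ 3 + of_real c))"
    unfolding green_def sum_distrib_left sum.distrib[symmetric]
    by (intro sum.cong refl) (simp add: algebra_simps)
  also have "\<dots> = 0" by (intro sum.neutral ballI) (simp only: root_eq mult_zero_right)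
  finally have "(\<Sum>j=1..4. (of_real a * weight j * r j ^ 4) * phi (r j) t) =
      - (of_real b * (\<Sum>j=1..4. weight j * r j ^ 3 * phi (r j) t) + of_real c * green t)"
    by (subst eq_neg_iff_add_eq_0, subst add.commute)
  then show ?case unfolding K resolvent_def volterra_kernel_def by simp
qed

end

section \<open>From convolutions back to derivatives\<close>

lemma AE_lebesgue_iff_negligible:
  fixes P :: "real \<Rightarrow> bool"
  shows "(AE x in lebesgue. P x) \<longleftrightarrow> negligible {x. \<not> P x}"
proof
  assume "AE x in lebesgue. P x"
  then obtain N where "N \<in> null_sets lebesgue" "{x. \<not> P x} \<subseteq> N"
    unfolding eventually_ae_filter by auto
  then show "negligible {x. \<not> P x}" by (meson negligible_iff_null_sets negligible_subset)
next
  assume "negligible {x. \<not> P x}"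
  then show "AE x in lebesgue. P x"
    by (intro AE_I'[of "{x. \<not> P x}"]) (auto simp: negligible_iff_null_sets)
qed

lemma AE_lborel_iff_negligible:
  fixes P :: "real \<Rightarrow> bool"
  shows "(AE x in lborel. P x) \<longleftrightarrow> negligible {x. \<not> P x}"
  by (simp add: AE_lebesgue_iff_negligible[symmetric] AE_completion_iff)

lemma continuous_AE_eq:
  fixes u v :: "real \<Rightarrow> complex"
  assumes "open S" "continuous_on S u" "continuous_on S v" "AE x in lborel. x \<in> S \<longrightarrow> u x = v x" "x \<in> S"
  shows "u x = v x"
proof -
  have "open {x \<in> S. u x - v x \<noteq> 0}"
    using continuous_open_preimage[of S "\<lambda>x. u x - v x" "- {0}"] assms
    by (auto intro!: continuous_intros simp: vimage_def Int_def)
  moreover have "negligible {x \<in> S. u x - v x \<noteq> 0}"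
    using assms(4) unfolding AE_lborel_iff_negligible by (rule negligible_subset) auto
  ultimately have "{x \<in> S. u x - v x \<noteq> 0} = {}" using open_not_negligible by blast
  then show ?thesis using assms(5) by auto
qed

text \<open>The representative is chosen equal to \<open>u\<close> everywhere if \<open>u\<close> is continuous, so that pointwise
  statements about a continuous force survive the passage to it.\<close>

lemma borel_representative:
  fixes u :: "real \<Rightarrow> real"
  assumes int: "\<And>t. t > 0 \<Longrightarrow> u absolutely_integrable_on {0..t}"
  obtains v where "(\<lambda>x. complex_of_real (v x)) \<in> causal_loc_int" "\<And>x. x \<le> 0 \<Longrightarrow> v x = 0"
    "AE x in lborel. x > 0 \<longrightarrow> v x = u x" "continuous_on {0<..} u \<longrightarrow> (\<forall>x>0. v x = u x)"
proof -
  have "\<exists>v \<in> borel_measurable borel. (\<forall>x\<le>0. v x = 0) \<and> (AE x in lborel. x > 0 \<longrightarrow> v x = u x) \<and>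
      (continuous_on {0<..} u \<longrightarrow> (\<forall>x>0. v x = u x))"
  proof (cases "continuous_on {0<..} u")
    case True
    then show ?thesis
      by (intro bexI[of _ "\<lambda>x. indicator {0<..} x *\<^sub>R u x"] borel_measurable_continuous_on_indicator) auto
  next
    case False
    have "(\<lambda>x. indicator {0..real (Suc n)} x *\<^sub>R u x) \<in> borel_measurable lebesgue" for n
      using int[of "real (Suc n)"] unfolding set_integrable_def by (intro borel_measurable_integrable) auto
    then have "(\<lambda>x. indicator {0..} x *\<^sub>R u x) \<in> borel_measurable lebesgue"
    proof (rule borel_measurable_LIMSEQ_real[rotated])
      fix x
      have "eventually (\<lambda>n. indicator {0..real (Suc n)} x *\<^sub>R u x = indicator {0..} x *\<^sub>R u x) sequentially"
        using eventually_ge_at_top[of "nat \<lceil>x\<rceil>"]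
      proof eventually_elim
        case (elim n)
        then have "x \<le> real (Suc n)" by linarith
        then show ?case by (auto simp: indicator_def)
      qed
      then show "(\<lambda>n. indicator {0..real (Suc n)} x *\<^sub>R u x) \<longlonglongrightarrow> indicator {0..} x *\<^sub>R u x"
        by (rule tendsto_eventually)
    qed
    from completion_ex_borel_measurable_real[OF this]
    obtain g where g: "g \<in> borel_measurable lborel" "AE x in lborel. indicator {0..} x *\<^sub>R u x = g x" by blast
    have [measurable]: "g \<in> borel_measurable borel" using g by simp
    show ?thesis
    proof (intro bexI[of _ "\<lambda>x. indicator {0<..} x *\<^sub>R g x"] conjI)
      show "AE x in lborel. x > 0 \<longrightarrow> indicator {0<..} x *\<^sub>R g x = u x"
        using g(2) by eventually_elim auto
    qed (use False in auto)
  qed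
  then obtain v where v: "v \<in> borel_measurable borel" "\<And>x. x \<le> 0 \<Longrightarrow> v x = 0"
    "AE x in lborel. x > 0 \<longrightarrow> v x = u x" "continuous_on {0<..} u \<longrightarrow> (\<forall>x>0. v x = u x)"
    by blast
  have "set_integrable lborel {..T} (\<lambda>x. complex_of_real (v x))" for T
  proof -
    define S where "S = max T 1"
    have "negligible ({x. \<not> (x > 0 \<longrightarrow> v x = u x)} \<union> {0})"
      using v(3) unfolding AE_lborel_iff_negligible by (intro negligible_Un) auto
    from absolutely_integrable_spike[OF int[of S] this]
    have "v absolutely_integrable_on {0..S}" by (auto simp: S_def)
    then have "set_integrable lborel {0..S} v" using v(1) by (subst (asm) set_integrable_lebesgue_iff) auto
    then have "set_integrable lborel ({0..S} \<inter> {..T}) v" by (rule set_integrable_subset) auto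
    then have "integrable lborel (\<lambda>x. complex_of_real (indicator ({0..S} \<inter> {..T}) x *\<^sub>R v x))"
      unfolding set_integrable_def by (rule integrable_of_real)
    also have "(\<lambda>x. complex_of_real (indicator ({0..S} \<inter> {..T}) x *\<^sub>R v x))
       = (\<lambda>x. indicator {..T} x *\<^sub>R complex_of_real (v x))"
      using v(2) by (auto simp: fun_eq_iff indicator_def S_def)
    finally show ?thesis unfolding set_integrable_def .
  qed
  then have "(\<lambda>x. complex_of_real (v x)) \<in> causal_loc_int"
    using v(1,2) by (auto simp: causal_loc_int_def)
  then show thesis using v(2-4) by (rule that)
qed

lemma conv_heaviside_Re:
  assumes "h \<in> causal_loc_int"
  shows "((\<lambda>x. Re (h x)) has_integral Re (conv heaviside h t)) {0..t}"
  using has_integral_linear[OF conv_heaviside[OF assms] bounded_linear_Re] by (simp add: o_def)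

lemma conv_real:
  assumes "\<And>x. u x \<in> \<real>" "\<And>x. v x \<in> \<real>"
  shows "conv u v t \<in> \<real>"
proof -
  have "u (t - x) * v x = complex_of_real (Re (u (t - x)) * Re (v x))" for x
    using assms[of "t - x"] assms[of x] by (metis Reals_cases Re_complex_of_real of_real_mult)
  then have "conv u v t = complex_of_real (\<integral>x. Re (u (t - x)) * Re (v x) \<partial>lborel)"
    unfolding conv_def by (simp only: integral_complex_of_real)
  then show ?thesis by simp
qed

lemma caputo_conv:
  assumes h: "h \<in> causal_loc_int" and ex: "conv_exists abel_kernel h t" and "t > 0"
    and D: "AE x in lborel. x > 0 \<longrightarrow> deriv (deriv y) x = Re (h x)"
  shows "(\<lambda>\<tau>. deriv (deriv y) \<tau> / (t - \<tau>) powr (1/2)) absolutely_integrable_on {0..t}"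
    "caputo_3_2 y t = Re (conv abel_kernel h t)"
proof -
  let ?N = "{x. \<not> (x > 0 \<longrightarrow> deriv (deriv y) x = Re (h x))} \<union> {0, t}"
  have N: "negligible ?N" using D unfolding AE_lborel_iff_negligible by (intro negligible_Un) auto
  note ki = conv_eq_integral[OF abel_kernel_loc_int h ex]
  let ?f = "\<lambda>x. sqrt pi * Re (abel_kernel (t - x) * h x)"
  let ?g = "\<lambda>\<tau>. deriv (deriv y) \<tau> / (t - \<tau>) powr (1/2)"
  have eq: "?g x = ?f x" if "x \<in> {0..t} - ?N" for x
  proof -
    from that have x: "0 < x" "x < t" "deriv (deriv y) x = Re (h x)" by auto
    then have "Re (abel_kernel (t - x) * h x) = 1 / (sqrt pi * sqrt (t - x)) * Re (h x)"
      by (simp add: abel_kernel_def)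
    then show ?thesis using x by (simp add: powr_half_sqrt)
  qed
  have "(Re \<circ> (\<lambda>x. abel_kernel (t - x) * h x)) absolutely_integrable_on {0..t}"
    using ki(1) bounded_linear_Re by (rule absolutely_integrable_linear)
  then have f: "?f absolutely_integrable_on {0..t}" by (simp add: o_def)
  show "?g absolutely_integrable_on {0..t}"
    by (rule absolutely_integrable_spike[OF f N]) (rule eq)
  have "integral {0..t} ?g = integral {0..t} ?f" by (rule integral_spike[OF N]) (rule eq[symmetric])
  also have "\<dots> = sqrt pi * integral {0..t} (\<lambda>x. Re (abel_kernel (t - x) * h x))" by simp
  also have "integral {0..t} (\<lambda>x. Re (abel_kernel (t - x) * h x)) = Re (conv abel_kernel h t)"
    using integral_linear[OF set_lebesgue_integral_eq_integral(1)[OF ki(1)] bounded_linear_Re] ki(2)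
    by (simp add: o_def)
  finally show "caputo_3_2 y t = Re (conv abel_kernel h t)"
    by (simp add: caputo_3_2_def Gamma_one_half_real)
qed

text \<open>Here \<open>h\<close> is the second derivative of \<open>y\<close>: almost everywhere by Lebesgue's theorem, and
  everywhere if \<open>h\<close> is continuous.\<close>

lemma double_integral_derivatives:
  fixes y :: "real \<Rightarrow> real"
  assumes h: "h \<in> causal_loc_int"
    and y: "\<And>t. t \<ge> 0 \<Longrightarrow> y t = y0 + y1 * t + Re (conv heaviside (conv heaviside h) t)"
  shows "y 0 = y0" "(y has_real_derivative y1) (at 0 within {0..})"
    "t > 0 \<Longrightarrow> (y has_real_derivative y1 + Re (conv heaviside h t)) (at t)"
    "t > 0 \<Longrightarrow> deriv y t = y1 + Re (conv heaviside h t)"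
    "AE t in lborel. t > 0 \<longrightarrow> (deriv y has_real_derivative Re (h t)) (at t)"
    "continuous_on {0<..} h \<Longrightarrow> t > 0 \<Longrightarrow> (deriv y has_real_derivative Re (h t)) (at t)"
proof -
  define p where "p = (\<lambda>t. Re (conv heaviside h t))"
  define q where "q = (\<lambda>t. Re (conv heaviside (conv heaviside h) t))"
  have "isCont p t" for t unfolding p_def by (rule isCont_Re, rule conv_isCont) (intro heaviside_regular h)+
  then have cp: "continuous_on S p" for S by (simp add: continuous_at_imp_continuous_on)
  have p_int: "p t = integral {0..t} (\<lambda>x. Re (h x))" for t
    unfolding p_def using conv_heaviside_Re[OF h] by (rule integral_unique[symmetric])
  have q_int: "q t = integral {0..t} p" for t
    unfolding p_def q_def using conv_heaviside_Re[OF conv_loc_int(2)[OF heaviside_regular(1) h]] by (rule integral_unique[symmetric])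
  have dq: "(q has_real_derivative p t) (at t within {0..T})" if "t \<in> {0..T}" for t T
    unfolding q_int[abs_def] has_real_derivative_iff_has_vector_derivative
    by (rule integral_has_vector_derivative[OF cp that])
  have d: "((\<lambda>t. y0 + y1 * t + q t) has_real_derivative y1 + p t) (at t within {0..T})" if "t \<in> {0..T}" for t T
    by (auto intro!: derivative_eq_intros dq[OF that])
  have dy: "(y has_real_derivative y1 + p t) (at t within {0..T})" if "t \<in> {0..T}" for t T
    by (rule has_field_derivative_transform_within[OF d[OF that] zero_less_one that]) (simp add: y q_def)
  have "p 0 = 0" "q 0 = 0" by (simp_all add: p_int q_int)
  then show "y 0 = y0" using y[of 0] by (simp add: q_def)
  have "(at 0 within {0..1}) = (at (0::real) within {0..})"
    by (rule at_within_nhd[of _ "{..<1}"]) auto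
  then show "(y has_real_derivative y1) (at 0 within {0..})" using dy[of 0 1] \<open>p 0 = 0\<close> by simp
  show dy': "(y has_real_derivative y1 + Re (conv heaviside h t)) (at t)" if "t > 0" for t
    using dy[of t "t + 1"] that at_within_Icc_at[of 0 t "t + 1"] by (simp add: p_def)
  then show y': "deriv y t = y1 + Re (conv heaviside h t)" if "t > 0" for t using that by (auto intro: DERIV_imp_deriv)
  have dp: "(deriv y has_real_derivative D) (at t)" if "t > 0" "(p has_real_derivative D) (at t)" for t D
  proof -
    have "((\<lambda>t. y1 + p t) has_real_derivative D) (at t)" using that by (auto intro!: derivative_eq_intros)
    then show ?thesis
      by (rule has_field_derivative_transform_within_open[of _ _ _ "{0<..}"])
        (use that y' in \<open>auto simp: p_def\<close>)
  qed
  define B where "B n = {x \<in> {0<..<real n}. \<not> (p has_real_derivative Re (h x)) (at x)}" for n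
  have "negligible (B n)" for n
    unfolding B_def p_int[abs_def]
    by (rule indefinite_integral_derivative_ae) (rule has_integral_integrable[OF conv_heaviside_Re[OF h]])
  then have N: "negligible (\<Union>n. B n)" by (intro negligible_countable_Union) auto
  show "AE t in lborel. t > 0 \<longrightarrow> (deriv y has_real_derivative Re (h t)) (at t)"
    unfolding AE_lborel_iff_negligible
  proof (rule negligible_subset[OF N], rule subsetI)
    fix t assume "t \<in> {t. \<not> (t > 0 \<longrightarrow> (deriv y has_real_derivative Re (h t)) (at t))}"
    then have t: "t > 0" and nd: "\<not> (deriv y has_real_derivative Re (h t)) (at t)" by auto
    obtain n where "t < real n" using reals_Archimedean2 by blast
    then have "t \<in> B n" using dp[OF t] nd t unfolding B_def by auto
    then show "t \<in> (\<Union>n. B n)" by blast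
  qed
  show "(deriv y has_real_derivative Re (h t)) (at t)" if c: "continuous_on {0<..} h" and t: "t > 0" for t
  proof (rule dp[OF t])
    have p_split: "p s = p (t / 2) + integral {t/2..s} (\<lambda>x. Re (h x))" if "s \<ge> t / 2" for s
      unfolding p_int
      using Henstock_Kurzweil_Integration.integral_combine[of 0 "t/2" s "\<lambda>x. Re (h x)",
          OF _ that has_integral_integrable[OF conv_heaviside_Re[OF h]]] t by simp
    have ch: "continuous_on {t/2..2*t} (\<lambda>x. Re (h x))"
      by (rule continuous_on_Re, rule continuous_on_subset[OF c]) (use t in auto)
    have "((\<lambda>s. integral {t/2..s} (\<lambda>x. Re (h x))) has_vector_derivative Re (h t)) (at t within {t/2..2*t})"
      by (rule integral_has_vector_derivative[OF ch]) (use t in auto)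
    then have "((\<lambda>s. integral {t/2..s} (\<lambda>x. Re (h x))) has_real_derivative Re (h t)) (at t)"
      using t at_within_Icc_at[of "t/2" t "2*t"] by (simp add: has_real_derivative_iff_has_vector_derivative)
    then have "((\<lambda>s. p (t/2) + integral {t/2..s} (\<lambda>x. Re (h x))) has_real_derivative Re (h t)) (at t)"
      by (auto intro!: derivative_eq_intros)
    then show "(p has_real_derivative Re (h t)) (at t)"
      by (rule has_field_derivative_transform_within_open[OF _ open_greaterThan[of "t/2"]])
        (use t in \<open>simp_all add: p_split[symmetric]\<close>)
  qed
qed

section \<open>The solution for an arbitrary force\<close>

context bagley_torvik
begin

text \<open>The right-hand side \<open>(f - c (y0 + y1 t)) / a\<close> of the Volterra equation for \<open>y''\<close>.\<close>

definition reduced_force :: "(real \<Rightarrow> complex) \<Rightarrow> real \<Rightarrow> real \<Rightarrow> real \<Rightarrow> complex" where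
  "reduced_force F y0 y1 t = of_real (1 / a) * F t + (of_real (- c * y0 / a) * heaviside t
     + of_real (- c * y1 / a) * conv heaviside heaviside t)"

text \<open>The second derivative of the solution.\<close>

definition acceleration :: "(real \<Rightarrow> complex) \<Rightarrow> real \<Rightarrow> real \<Rightarrow> real \<Rightarrow> complex" where
  "acceleration F y0 y1 t = reduced_force F y0 y1 t + conv resolvent (reduced_force F y0 y1) t"

lemma reduced_force_loc_int: "F \<in> causal_loc_int \<Longrightarrow> reduced_force F y0 y1 \<in> causal_loc_int"
  unfolding reduced_force_def[abs_def]
  by (intro causal_loc_int_add causal_loc_int_scale conv_loc_int heaviside_regular)

lemma acceleration_loc_int: "F \<in> causal_loc_int \<Longrightarrow> acceleration F y0 y1 \<in> causal_loc_int"
  unfolding acceleration_def[abs_def] by (intro causal_loc_int_add conv_loc_int(2) resolvent_loc_int reduced_force_loc_int)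

lemma acceleration_volterra:
  assumes "F \<in> causal_loc_int"
  shows "AE t in lborel. acceleration F y0 y1 t + conv volterra_kernel (acceleration F y0 y1) t = reduced_force F y0 y1 t"
  by (rule resolvent_inverse[OF volterra_kernel_loc_int resolvent_loc_int reduced_force_loc_int acceleration_loc_int resolvent_equation]) (auto simp: assms acceleration_def)

lemma volterra_unique:
  assumes F: "F \<in> causal_loc_int" and h: "h \<in> causal_loc_int"
    and eq: "AE t in lborel. h t + conv volterra_kernel h t = reduced_force F y0 y1 t"
  shows "h \<doteq> acceleration F y0 y1"
proof -
  have "AE t in lborel. resolvent t + volterra_kernel t + conv resolvent volterra_kernel t = 0"
    using resolvent_equation by (simp add: conv_commute[of resolvent] add.commute)
  moreover have "AE t in lborel. reduced_force F y0 y1 t = h t + conv volterra_kernel h t" using eq by eventually_elim simp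
  ultimately have "AE t in lborel. reduced_force F y0 y1 t + conv resolvent (reduced_force F y0 y1) t = h t"
    by (rule resolvent_inverse[OF resolvent_loc_int volterra_kernel_loc_int h reduced_force_loc_int[OF F]])
  then show ?thesis by eventually_elim (simp add: acceleration_def)
qed

lemma green_bounded: "loc_bounded green"
proof (rule causal_extension)
  show "continuous_on {0..} green"
    unfolding green_def[abs_def] by (intro continuous_on_sum continuous_on_mult continuous_on_const phi_regular)
  show "green x = (if 0 \<le> x then green x else 0)" for x using causal_loc_intD(2)[OF green_loc_int] by auto
qed

lemma conv_heaviside_green:
  "conv heaviside green t = (\<Sum>j=1..4. (weight j / r j ^ 2) * phi (r j) t) + of_real (1 / c) * heaviside t"
proof -
  have "conv heaviside green t = conv heaviside (\<lambda>t. \<Sum>j=1..4. weight j * phi (r j) t) t"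
    by (simp add: green_def[abs_def])
  then show ?thesis unfolding conv_heaviside_phi_sum weight_moments by simp
qed

lemma conv_heaviside_heaviside_green:
  "conv heaviside (conv heaviside green) t =
     (\<Sum>j=1..4. (weight j / r j ^ 4) * phi (r j) t) + of_real (1 / c) * conv heaviside heaviside t"
proof -
  have "conv heaviside (conv heaviside green) t =
      conv heaviside (\<lambda>t. \<Sum>j=1..4. (weight j / r j ^ 2) * phi (r j) t) t + of_real (1 / c) * conv heaviside heaviside t"
    unfolding conv_heaviside_green[abs_def]
    by (simp only: conv_add_right conv_scale_right conv_exists_heaviside phi_sum_loc_int heaviside_regular causal_loc_int_scale)
  moreover have "(\<Sum>j=1..4. (weight j / r j ^ 2) / r j ^ 2) = (\<Sum>j=1..4. weight j / r j ^ 4)"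
    "(\<Sum>j=1..4. (weight j / r j ^ 2) / r j) = (\<Sum>j=1..4. weight j / r j ^ 3)"
    "(\<Sum>j=1..4. (weight j / r j ^ 2) / r j ^ 2 * phi (r j) t) = (\<Sum>j=1..4. (weight j / r j ^ 4) * phi (r j) t)"
    by (simp_all add: power_numeral_reduce mult.assoc)
  ultimately show ?thesis unfolding conv_heaviside_phi_sum weight_moments by simp
qed

text \<open>The two coefficients are the solutions with initial values \<open>(1, 0)\<close> and \<open>(0, 1)\<close> and without force;
  subtracting \<open>y0 + y1 t\<close> turns the initial values into the force \<open>- c (y0 + y1 t)\<close>.
  The root equation in the form \<open>a r + b = - c / r^3\<close> matches the coefficients.\<close>

lemma initial_part_green:
  assumes t: "t \<ge> 0"
  shows "bt_initial_part a b r y0 y1 t = of_real y0 * (1 - of_real c * conv heaviside green t)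
    + of_real y1 * (of_real t - of_real c * conv heaviside (conv heaviside green) t)"
proof -
  have cz: "complex_of_real c \<noteq> 0" using c_nz by simp
  have coef: "(of_real a * r k + of_real b) * ((r k)\<^sup>2 * of_real y0 + of_real y1) /
        ((4 * of_real a * r k + 3 * of_real b) * (r k)\<^sup>2) =
      - of_real c * (of_real y0 * (weight k / r k ^ 2) + of_real y1 * (weight k / r k ^ 4))" if k: "k \<in> {1..4}" for k
  proof -
    have nz: "r k \<noteq> 0" using root_nz k .
    have e: "of_real a * r k + of_real b = - of_real c / r k ^ 3"
      using root_eq[OF k] nz by (simp add: field_simps power_numeral_reduce eq_neg_iff_add_eq_0)
    have w: "1 / ((4 * of_real a * r k + 3 * of_real b) * (r k)\<^sup>2) = weight k / r k"
      by (simp add: weight_def power2_eq_square)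
    have "(of_real a * r k + of_real b) * ((r k)\<^sup>2 * of_real y0 + of_real y1) /
        ((4 * of_real a * r k + 3 * of_real b) * (r k)\<^sup>2)
      = (of_real a * r k + of_real b) * ((r k)\<^sup>2 * of_real y0 + of_real y1) * (weight k / r k)"
      unfolding w[symmetric] by simp
    also have "\<dots> = - of_real c * (of_real y0 * (weight k / r k ^ 2) + of_real y1 * (weight k / r k ^ 4))"
      unfolding e using nz by (simp add: field_simps power_numeral_reduce)
    finally show ?thesis .
  qed
  have "bt_initial_part a b r y0 y1 t = (\<Sum>k=1..4. - of_real c * (of_real y0 * (weight k / r k ^ 2 * phi (r k) t)
      + of_real y1 * (weight k / r k ^ 4 * phi (r k) t)))"
    unfolding bt_initial_part_def
  proof (intro sum.cong refl)
    fix k :: nat assume k: "k \<in> {1..4}"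
    show "(of_real a * r k + of_real b) * ((r k)\<^sup>2 * of_real y0 + of_real y1) /
        ((4 * of_real a * r k + 3 * of_real b) * (r k)\<^sup>2) * exp ((r k)\<^sup>2 * of_real t) * erfc (- r k * of_real (sqrt t))
       = - of_real c * (of_real y0 * (weight k / r k ^ 2 * phi (r k) t) + of_real y1 * (weight k / r k ^ 4 * phi (r k) t))"
      unfolding coef[OF k] using t by (simp add: phi_def algebra_simps)
  qed
  also have "\<dots> = - of_real c * (of_real y0 * (\<Sum>k=1..4. weight k / r k ^ 2 * phi (r k) t)
      + of_real y1 * (\<Sum>k=1..4. weight k / r k ^ 4 * phi (r k) t))"
    unfolding sum_distrib_left sum.distrib[symmetric] by (rule refl)
  finally show ?thesis
    unfolding conv_heaviside_green conv_heaviside_heaviside_green conv_heaviside_heaviside[OF t]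
    using t cz by (simp add: heaviside_def algebra_simps)
qed

text \<open>The double integral is moved onto the resolvent, where it produces the Green function.\<close>

lemma double_integral_acceleration:
  assumes F: "F \<in> causal_loc_int" and t: "t \<ge> 0"
  shows "of_real y0 + of_real y1 * of_real t + conv heaviside (conv heaviside (acceleration F y0 y1)) t
    = conv F green t + bt_initial_part a b r y0 y1 t"
proof -
  let ?H = heaviside and ?g = "reduced_force F y0 y1"
  note g = reduced_force_loc_int[OF F, of y0 y1] and hb = heaviside_regular(2)
  have az: "complex_of_real a \<noteq> 0" using a_nz by simp
  have ex: "conv_exists green w t" if "w \<in> causal_loc_int" for w
    by (intro conv_exists_bounded green_loc_int green_bounded that)
  have "conv ?H (acceleration F y0 y1) = (\<lambda>s. conv ?H ?g s + conv ?H (conv resolvent ?g) s)"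
    unfolding acceleration_def[abs_def] by (rule ext, rule conv_add_right)
      (intro conv_exists_heaviside g conv_loc_int(2) resolvent_loc_int)+
  then have "conv ?H (conv ?H (acceleration F y0 y1)) t
      = conv ?H (conv ?H ?g) t + conv ?H (conv ?H (conv resolvent ?g)) t"
    by (simp only: conv_add_right conv_exists_heaviside g conv_loc_int(2) resolvent_loc_int heaviside_regular(1))
  also have "conv ?H (conv ?H ?g) t = conv (conv ?H ?H) ?g t"
    by (intro conv_assoc_bounded heaviside_regular g)
  also have "conv ?H (conv resolvent ?g) = conv (conv ?H resolvent) ?g"
    by (rule ext) (intro conv_assoc_bounded heaviside_regular g resolvent_loc_int)
  also have "conv ?H (conv (conv ?H resolvent) ?g) t = conv (conv ?H (conv ?H resolvent)) ?g t"
    by (intro conv_assoc_bounded heaviside_regular g conv_loc_int(2) resolvent_loc_int)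
  also have "conv ?H (conv ?H resolvent) = (\<lambda>s. of_real a * green s + (- 1) * conv ?H ?H s)"
    by (simp add: conv_heaviside_heaviside_resolvent fun_eq_iff)
  also have "conv (\<lambda>s. of_real a * green s + (- 1) * conv ?H ?H s) ?g t
      = of_real a * conv green ?g t + (- 1) * conv (conv ?H ?H) ?g t"
  proof -
    have "conv_exists (conv ?H ?H) ?g t"
      by (intro conv_exists_bounded conv_loc_int(2) heaviside_regular g ramp_bounded)
    then show ?thesis using ex[OF g] by (simp only: conv_add_left conv_scale_left conv_exists_scale_left)
  qed
  finally have 1: "conv ?H (conv ?H (acceleration F y0 y1)) t = of_real a * conv green ?g t" by simp
  have "conv green ?g t = of_real (1 / a) * conv green F t + (of_real (- c * y0 / a) * conv green ?H t
     + of_real (- c * y1 / a) * conv green (conv ?H ?H) t)"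
    unfolding reduced_force_def[abs_def]
    by (simp only: conv_add_right conv_scale_right ex causal_loc_int_add causal_loc_int_scale F heaviside_regular(1)
        conv_loc_int(2))
  also have "conv green ?H t = conv ?H green t" by (rule conv_commute)
  also have "conv green (conv ?H ?H) t = conv ?H (conv ?H green) t"
    unfolding conv_commute[of green] by (intro conv_assoc_bounded[symmetric] heaviside_regular green_loc_int)
  also have "conv green F t = conv F green t" by (rule conv_commute)
  finally show ?thesis unfolding 1 initial_part_green[OF t] using az by (simp add: field_simps)
qed

text \<open>Conjugation permutes the roots of the real polynomial.\<close>

lemma root_sum_real:
  assumes "\<And>z. g (cnj z) = cnj (g z)"
  shows "(\<Sum>j=1..4. g (r j)) \<in> \<real>"
proof -
  let ?Z = "{z. bt_poly a b c z = 0}"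
  have "bt_poly a b c (cnj z) = cnj (bt_poly a b c z)" for z by (simp add: bt_poly_def)
  then have "bij_betw cnj ?Z ?Z"
    by (intro bij_betw_byWitness[where f' = cnj]) auto
  then have "(\<Sum>z\<in>?Z. g z) = (\<Sum>z\<in>?Z. g (cnj z))" by (rule sum.reindex_bij_betw[symmetric])
  also have "\<dots> = cnj (\<Sum>z\<in>?Z. g z)" by (simp add: assms)
  finally have "(\<Sum>z\<in>?Z. g z) \<in> \<real>" by (simp add: Reals_cnj_iff)
  then show ?thesis unfolding sum.reindex_bij_betw[OF roots] .
qed

lemma abel_kernel_real: "abel_kernel t \<in> \<real>" and heaviside_real: "heaviside t \<in> \<real>"
  by (auto simp: abel_kernel_def heaviside_def)

lemma resolvent_real: "resolvent t \<in> \<real>"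
proof -
  have "(\<Sum>j=1..4. (of_real a * (1 / ((4 * of_real a * r j + 3 * of_real b) * r j)) * r j ^ 4) * phi (r j) t) \<in> \<real>"
    by (rule root_sum_real) (simp add: phi_cnj)
  then show ?thesis unfolding resolvent_def weight_def
    by (intro Reals_add Reals_mult abel_kernel_real) auto
qed

lemma acceleration_real: "(\<And>x. F x \<in> \<real>) \<Longrightarrow> acceleration F y0 y1 t \<in> \<real>"
  unfolding acceleration_def reduced_force_def[abs_def]
  by (intro Reals_add Reals_mult Reals_of_real conv_real resolvent_real heaviside_real)

lemma force_part_conv:
  assumes F: "(\<lambda>x. complex_of_real (v x)) \<in> causal_loc_int" and v: "AE x in lborel. x > 0 \<longrightarrow> v x = f x"
  shows "bt_force_part a b r f t = conv (\<lambda>x. complex_of_real (v x)) green t"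
proof -
  let ?F = "\<lambda>x. complex_of_real (v x)"
  have ex: "conv_exists ?F green t"
    unfolding conv_exists_commute[of ?F] by (intro conv_exists_bounded green_loc_int green_bounded F)
  have N: "negligible ({x. \<not> (t - x > 0 \<longrightarrow> v (t - x) = f (t - x))} \<union> {t})"
    using AE_lborel_reflect[OF v, of t] unfolding AE_lborel_iff_negligible by (intro negligible_Un) auto
  have "bt_force_part a b r f t = integral {0..t} (\<lambda>x. ?F (t - x) * green x)"
    unfolding bt_force_part_def
  proof (rule integral_spike[OF N])
    fix x assume x: "x \<in> {0..t} - ({x. \<not> (t - x > 0 \<longrightarrow> v (t - x) = f (t - x))} \<union> {t})"
    then have "x \<ge> 0" "v (t - x) = f (t - x)" by auto
    then show "?F (t - x) * green x = of_real (f (t - x)) *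
       (\<Sum>k=1..4. exp ((r k)\<^sup>2 * of_real x) * erfc (- r k * of_real (sqrt x)) /
                   ((4 * of_real a * r k + 3 * of_real b) * r k))"
      by (simp add: green_def weight_def phi_def)
  qed
  also have "\<dots> = conv ?F green t" by (rule conv_eq_integral(2)[OF F green_loc_int ex])
  finally show ?thesis .
qed

text \<open>The equation for \<open>y\<close> at a point is \<open>a\<close> times the Volterra equation for \<open>h\<close> at this point.\<close>

lemma equation_at_iff:
  assumes h: "h \<in> causal_loc_int" "\<And>x. h x \<in> \<real>" and t: "t > 0"
    and y: "\<And>t. t \<ge> 0 \<Longrightarrow> y t = y0 + y1 * t + Re (conv heaviside (conv heaviside h) t)"
    and d: "(deriv y has_real_derivative Re (h t)) (at t)"
    and ex: "conv_exists abel_kernel h t"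
    and F: "F t = of_real (f t)"
  shows "bt_equation_at a b c f y t \<longleftrightarrow> h t + conv volterra_kernel h t = reduced_force F y0 y1 t"
proof -
  let ?H = heaviside
  have D: "AE x in lborel. x > 0 \<longrightarrow> deriv (deriv y) x = Re (h x)"
  proof -
    have "AE x in lborel. x > 0 \<longrightarrow> (deriv y has_real_derivative Re (h x)) (at x)"
      by (rule double_integral_derivatives(5)[OF h(1)]) (rule y)
    then show ?thesis by eventually_elim (auto intro: DERIV_imp_deriv)
  qed
  note cap = caputo_conv[OF h(1) ex t D]
  have dd: "deriv (deriv y) t = Re (h t)" using d by (rule DERIV_imp_deriv)
  have az: "complex_of_real a \<noteq> 0" using a_nz by simp
  have "y differentiable at t" "deriv y differentiable at t"
    using double_integral_derivatives(3)[where y = y, OF h(1) _ t] y d by (auto simp: real_differentiable_def)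
  then have "bt_equation_at a b c f y t \<longleftrightarrow> a * Re (h t) + b * Re (conv abel_kernel h t) + c * y t = f t"
    unfolding bt_equation_at_def using cap dd by simp
  also have "\<dots> \<longleftrightarrow> complex_of_real (a * Re (h t) + b * Re (conv abel_kernel h t) + c * y t) = of_real (f t)"
    by (rule of_real_eq_iff[symmetric])
  also have "complex_of_real (a * Re (h t) + b * Re (conv abel_kernel h t) + c * y t) =
     of_real a * h t + of_real b * conv abel_kernel h t
      + of_real c * (of_real y0 + of_real y1 * of_real t + conv ?H (conv ?H h) t)"
    using h(2)[of t] conv_real[of abel_kernel h t, OF abel_kernel_real h(2)]
      conv_real[of ?H "conv ?H h" t, OF heaviside_real conv_real[OF heaviside_real h(2)]] t
    by (simp add: y of_real_Re)
  also have "conv ?H (conv ?H h) t = conv (conv ?H ?H) h t"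
    by (intro conv_assoc_bounded heaviside_regular h)
  also have "of_real a * h t + of_real b * conv abel_kernel h t
      + of_real c * (of_real y0 + of_real y1 * of_real t + conv (conv ?H ?H) h t)
    = of_real a * (h t + conv volterra_kernel h t) + of_real c * (of_real y0 + of_real y1 * of_real t)"
  proof -
    have "conv_exists (conv ?H ?H) h t"
      by (intro conv_exists_bounded conv_loc_int(2) heaviside_regular h ramp_bounded)
    then have "conv volterra_kernel h t = of_real (b / a) * conv abel_kernel h t + of_real (c / a) * conv (conv ?H ?H) h t"
      unfolding volterra_kernel_def[abs_def] using ex by (simp only: conv_add_left conv_scale_left conv_exists_scale_left)
    then show ?thesis using az by (simp add: field_simps)
  qed
  also have "of_real (f t) = of_real a * reduced_force F y0 y1 t + of_real c * (of_real y0 + of_real y1 * of_real t)"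
    unfolding reduced_force_def F using t az by (simp add: heaviside_def conv_heaviside_heaviside field_simps)
  finally show ?thesis using az by simp
qed


lemma acceleration_formula:
  assumes F: "F \<in> causal_loc_int" "\<And>x. F x \<in> \<real>" and t: "t \<ge> 0"
  shows "conv F green t + bt_initial_part a b r y0 y1 t =
     of_real (y0 + y1 * t + Re (conv heaviside (conv heaviside (acceleration F y0 y1)) t))"
proof -
  have "conv heaviside (conv heaviside (acceleration F y0 y1)) t \<in> \<real>"
    by (intro conv_real heaviside_real acceleration_real F)
  then show ?thesis unfolding double_integral_acceleration[OF F(1) t, symmetric] by (simp add: of_real_Re)
qed

text \<open>The exceptional points are those where \<open>y'\<close> is not differentiable, where the Abel integral diverges,
  where the force differs from its representative, or where the Volterra equation itself fails.\<close>

lemma acceleration_imp_solution: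
  assumes F: "(\<lambda>x. complex_of_real (v x)) \<in> causal_loc_int" and v: "AE x in lborel. x > 0 \<longrightarrow> v x = f x"
    and h_def: "h = acceleration (\<lambda>x. complex_of_real (v x)) y0 y1"
    and y: "\<And>t. t \<ge> 0 \<Longrightarrow> y t = y0 + y1 * t + Re (conv heaviside (conv heaviside h) t)"
  shows "bt_solution a b c f y0 y1 y"
proof -
  have h: "h \<in> causal_loc_int" "h x \<in> \<real>" for x
    unfolding h_def by (auto intro: acceleration_loc_int F acceleration_real)
  note did = double_integral_derivatives[where y = y and h = h and ?y0.0 = y0 and ?y1.0 = y1, OF h(1)]
  have d5: "AE t in lborel. t > 0 \<longrightarrow> (deriv y has_real_derivative Re (h t)) (at t)"
    by (rule did(5)) (rule y)
  have D: "AE t in lborel. t > 0 \<longrightarrow> deriv (deriv y) t = Re (h t)"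
    using d5 by eventually_elim (auto intro: DERIV_imp_deriv)
  have N: "negligible ({t. \<not> (t > 0 \<longrightarrow> deriv (deriv y) t = Re (h t))} \<union> {0})"
    using D unfolding AE_lborel_iff_negligible by (intro negligible_Un) auto
  have Re_h: "(\<lambda>x. Re (h x)) absolutely_integrable_on {0..t}" for t
  proof -
    have "set_integrable lborel {0..t} h"
      by (rule set_integrable_subset[OF causal_loc_intD(3)[OF h(1), of t]]) auto
    then have "h absolutely_integrable_on {0..t}"
      by (subst set_integrable_lebesgue_iff) (auto intro: causal_loc_intD(1)[OF h(1)])
    from absolutely_integrable_linear[OF this bounded_linear_Re] show ?thesis by (simp add: o_def)
  qed
  have "AE t in lborel. t > 0 \<longrightarrow> bt_equation_at a b c f y t"
    using d5 v acceleration_volterra[OF F, of y0 y1] conv_loc_int(1)[OF abel_kernel_loc_int h(1)]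
  proof eventually_elim
    case (elim t)
    show ?case
    proof
      assume t: "t > 0"
      have "bt_equation_at a b c f y t \<longleftrightarrow> h t + conv volterra_kernel h t = reduced_force (\<lambda>x. complex_of_real (v x)) y0 y1 t"
        by (rule equation_at_iff[OF h t y _ elim(4)]) (use elim t in auto)
      then show "bt_equation_at a b c f y t" using elim(3) by (simp add: h_def)
    qed
  qed
  then have "AE t in lebesgue. t > 0 \<longrightarrow> bt_equation_at a b c f y t" by (rule AE_completion)
  moreover have "y 0 = y0" by (rule did(1)) (rule y)
  moreover have "(y has_real_derivative y1) (at 0 within {0..})" by (rule did(2)) (rule y)
  moreover have "y differentiable at t" if "t > 0" for t
  proof -
    have "(y has_real_derivative y1 + Re (conv heaviside h t)) (at t)" by (rule did(3)) (use y that in auto)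
    then show ?thesis by (auto simp: real_differentiable_def)
  qed
  moreover have "deriv (deriv y) absolutely_integrable_on {0..t}" if "t > 0" for t
    by (rule absolutely_integrable_spike[OF Re_h N]) auto
  moreover have "deriv y t = y1 + integral {0..t} (deriv (deriv y))" if "t > 0" for t
  proof -
    have "integral {0..t} (deriv (deriv y)) = integral {0..t} (\<lambda>x. Re (h x))"
      by (rule integral_spike[OF N]) auto
    also have "\<dots> = Re (conv heaviside h t)" using conv_heaviside_Re[OF h(1)] by (rule integral_unique)
    finally show ?thesis using did(4)[of t] y that by auto
  qed
  ultimately show ?thesis unfolding bt_solution_def by blast
qed

text \<open>The second derivative of a solution solves the Volterra equation almost everywhere, hence agrees
  almost everywhere with \<open>acceleration\<close>; their double integrals then coincide at every point.\<close>

lemma solution_imp_acceleration: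
  assumes F: "(\<lambda>x. complex_of_real (v x)) \<in> causal_loc_int" and v: "AE x in lborel. x > 0 \<longrightarrow> v x = f x"
    and sol: "bt_solution a b c f y0 y1 y" and "t \<ge> 0"
  shows "y t = y0 + y1 * t + Re (conv heaviside (conv heaviside (acceleration (\<lambda>x. complex_of_real (v x)) y0 y1)) t)"
proof -
  let ?H = heaviside and ?F = "\<lambda>x. complex_of_real (v x)"
  have s0: "y 0 = y0" and s1: "(y has_real_derivative y1) (at 0 within {0..})"
    and s2: "\<And>t. t > 0 \<Longrightarrow> y differentiable at t"
    and s3: "\<And>t. t > 0 \<Longrightarrow> deriv (deriv y) absolutely_integrable_on {0..t}"
    and s4: "\<And>t. t > 0 \<Longrightarrow> deriv y t = y1 + integral {0..t} (deriv (deriv y))"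
    and s5: "AE t in lebesgue. t > 0 \<longrightarrow> bt_equation_at a b c f y t"
    using sol unfolding bt_solution_def by blast+
  obtain w where w: "(\<lambda>x. complex_of_real (w x)) \<in> causal_loc_int"
    "AE x in lborel. x > 0 \<longrightarrow> w x = deriv (deriv y) x"
    using borel_representative[OF s3] by metis
  define h where "h = (\<lambda>x. complex_of_real (w x))"
  have h: "h \<in> causal_loc_int" "h x \<in> \<real>" "Re (h x) = w x" for x using w by (auto simp: h_def)
  have N: "negligible ({t. \<not> (t > 0 \<longrightarrow> w t = deriv (deriv y) t)} \<union> {0})"
    using w(2) unfolding AE_lborel_iff_negligible by (intro negligible_Un) auto
  have dy: "deriv y t = y1 + Re (conv ?H h t)" if "t > 0" for t
  proof -
    have "integral {0..t} (deriv (deriv y)) = integral {0..t} (\<lambda>x. Re (h x))"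
      by (rule integral_spike[OF N]) (auto simp: h(3))
    also have "\<dots> = Re (conv ?H h t)" using conv_heaviside_Re[OF h(1)] by (rule integral_unique)
    finally show ?thesis using s4[OF that] by simp
  qed
  have "continuous_on {0..} y"
    unfolding continuous_on_eq_continuous_within
  proof
    fix x :: real assume "x \<in> {0..}"
    then show "continuous (at x within {0..}) y"
    proof (cases "x = 0")
      case True
      then show ?thesis using DERIV_continuous[OF s1] by simp
    next
      case False
      then have "y differentiable at x" using s2 \<open>x \<in> {0..}\<close> by auto
      then show ?thesis
        using differentiable_imp_continuous_within continuous_at_imp_continuous_at_within by blast
    qed
  qed
  then have cy: "continuous_on {0..t} y" for t by (rule continuous_on_subset) auto
  have yh: "y t = y0 + y1 * t + Re (conv ?H (conv ?H h) t)" if t: "t \<ge> 0" for t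
  proof -
    have "(y has_vector_derivative y1 + Re (conv ?H h x)) (at x)" if "x \<in> {0<..<t}" for x
      using s2[of x] dy[of x] that
      by (simp add: DERIV_deriv_iff_real_differentiable[symmetric] has_real_derivative_iff_has_vector_derivative)
    from fundamental_theorem_of_calculus_interior[OF t cy this]
    have "((\<lambda>x. y1 + Re (conv ?H h x)) has_integral y t - y 0) {0..t}" .
    moreover have "((\<lambda>x. y1 + Re (conv ?H h x)) has_integral t * y1 + Re (conv ?H (conv ?H h) t)) {0..t}"
      using has_integral_const_real[of y1 0 t] t
      by (intro has_integral_add conv_heaviside_Re conv_loc_int(2) heaviside_regular h) simp
    ultimately have "y t - y 0 = t * y1 + Re (conv ?H (conv ?H h) t)" by (rule has_integral_unique)
    then show ?thesis using s0 by (simp add: algebra_simps)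
  qed
  note did = double_integral_derivatives[where y = y and h = h and ?y0.0 = y0 and ?y1.0 = y1, OF h(1)]
  have d5: "AE t in lborel. t > 0 \<longrightarrow> (deriv y has_real_derivative Re (h t)) (at t)"
    by (rule did(5)) (rule yh)
  have s5': "AE t in lborel. t > 0 \<longrightarrow> bt_equation_at a b c f y t"
    using s5 unfolding AE_completion_iff .
  \<comment> \<open>On the negative half-line both sides vanish by causality.\<close>
  have "AE t in lborel. h t + conv volterra_kernel h t = reduced_force ?F y0 y1 t"
    using d5 v s5' conv_loc_int(1)[OF abel_kernel_loc_int h(1)] AE_lborel_singleton[of 0]
  proof eventually_elim
    case (elim t)
    show ?case
    proof (cases "t > 0")
      case True
      have "bt_equation_at a b c f y t \<longleftrightarrow> h t + conv volterra_kernel h t = reduced_force ?F y0 y1 t"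
        by (rule equation_at_iff[OF h(1,2) True yh _ elim(4)]) (use elim True in auto)
      then show ?thesis using elim(3) True by blast
    next
      case False
      with elim(5) have "t < 0" by simp
      then show ?thesis
        using conv_neg[OF volterra_kernel_loc_int h(1)] causal_loc_intD(2)[OF h(1)] causal_loc_intD(2)[OF reduced_force_loc_int[OF F]] by simp
    qed
  qed
  from volterra_unique[OF F h(1) this] have "h \<doteq> acceleration ?F y0 y1" .
  then have "conv ?H h s = conv ?H (acceleration ?F y0 y1) s" for s
    by (intro conv_cong_AE) (auto intro: causal_loc_intD heaviside_regular h acceleration_loc_int F)
  then have "conv ?H h = conv ?H (acceleration ?F y0 y1)" ..
  then show ?thesis using yh[OF \<open>t \<ge> 0\<close>] by simp
qed

lemma acceleration_equation_everywhere:
  assumes F: "(\<lambda>x. complex_of_real (v x)) \<in> causal_loc_int" and v: "\<And>x. x > 0 \<Longrightarrow> v x = f x"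
    and f: "continuous_on {0<..} f"
    and h_def: "h = acceleration (\<lambda>x. complex_of_real (v x)) y0 y1"
    and y: "\<And>t. t \<ge> 0 \<Longrightarrow> y t = y0 + y1 * t + Re (conv heaviside (conv heaviside h) t)"
    and t: "t > 0"
  shows "bt_equation_at a b c f y t"
proof -
  let ?F = "\<lambda>x. complex_of_real (v x)"
  have h: "h \<in> causal_loc_int" "h x \<in> \<real>" for x
    unfolding h_def by (auto intro: acceleration_loc_int F acceleration_real)
  have ch: "continuous_on {0<..} heaviside"
    by (rule continuous_on_eq[of _ "\<lambda>_. 1"]) (auto simp: heaviside_def)
  have cp: "continuous_on {0<..} (phi z)" for z by (rule continuous_on_subset[OF phi_regular(4)]) auto
  have cr: "continuous_on {0<..} (conv heaviside heaviside)"
    using conv_continuous(2)[OF heaviside_regular(1) ch heaviside_regular(1) ch] .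
  have ck: "continuous_on {0<..} volterra_kernel"
    unfolding volterra_kernel_def[abs_def] by (intro continuous_intros continuous_on_abel_kernel cr)
  have cres: "continuous_on {0<..} resolvent"
    unfolding resolvent_def[abs_def] by (intro continuous_intros continuous_on_abel_kernel cp)
  have "continuous_on {0<..} v" using f by (rule continuous_on_eq) (simp add: v)
  then have crhs: "continuous_on {0<..} (reduced_force ?F y0 y1)"
    unfolding reduced_force_def[abs_def] by (intro continuous_intros ch cr)
  have chh: "continuous_on {0<..} h"
    unfolding h_def acceleration_def[abs_def]
    by (intro continuous_on_add crhs conv_continuous(2) resolvent_loc_int cres reduced_force_loc_int F)
  have ex: "conv_exists abel_kernel h t"
    by (rule conv_continuous(1)[OF abel_kernel_loc_int continuous_on_abel_kernel h(1) chh t])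
  have "h t + conv volterra_kernel h t = reduced_force ?F y0 y1 t"
  proof (rule continuous_AE_eq[where S = "{0<..}"])
    show "continuous_on {0<..} (\<lambda>t. h t + conv volterra_kernel h t)"
      by (intro continuous_on_add chh conv_continuous(2) volterra_kernel_loc_int ck h)
    show "AE x in lborel. x \<in> {0<..} \<longrightarrow> h x + conv volterra_kernel h x = reduced_force ?F y0 y1 x"
      using acceleration_volterra[OF F, of y0 y1] unfolding h_def by eventually_elim simp
  qed (use t crhs in auto)
  moreover have "(deriv y has_real_derivative Re (h t)) (at t)"
    by (rule double_integral_derivatives(6)[OF h(1) y chh t])
  ultimately show ?thesis
    using equation_at_iff[OF h t y _ ex, of ?F f] v[OF t] by simp
qed

end

section \<open>The closed form of the roots\<close>

lemma root3_of_real_cube: "x \<ge> 0 \<Longrightarrow> complex_of_real (root 3 x) ^ 3 = of_real x"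
  by (simp flip: of_real_power)

text \<open>Ferrari's factorization. After the shift \<open>x = z + \<beta> / 4\<close> the product is
  \<open>((x - R)^2 - Tp^2) ((x + R)^2 - Tm^2)\<close>. Its coefficients of \<open>x^2\<close> and \<open>x\<close> match by the choice of
  \<open>Tp\<close> and \<open>Tm\<close>, and the constant term by the cubic for \<open>m\<close>.\<close>

lemma ferrari_identity:
  fixes \<beta> \<gamma> m R Tp Tm z :: complex
  assumes m: "m ^ 3 = \<gamma> * (\<beta>\<^sup>2 + 4 * m)" and R: "R \<noteq> 0" "4 * R\<^sup>2 = \<beta>\<^sup>2 / 4 + m"
    and Tp: "4 * Tp\<^sup>2 = \<beta>\<^sup>2 / 2 - m - \<beta> ^ 3 / (8 * R)"
    and Tm: "4 * Tm\<^sup>2 = \<beta>\<^sup>2 / 2 - m + \<beta> ^ 3 / (8 * R)"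
  shows "(z - (- \<beta> / 4 + R + Tp)) * (z - (- \<beta> / 4 - R + Tm)) * (z - (- \<beta> / 4 + R - Tp)) * (z - (- \<beta> / 4 - R - Tm))
    = z ^ 4 + \<beta> * z ^ 3 + \<gamma>"
proof -
  define x where "x = z + \<beta> / 4"
  define e where "e = \<beta> ^ 3 / (8 * R)"
  have eR: "8 * R * e = \<beta> ^ 3" using R(1) by (simp add: e_def)
  have m': "m = 4 * R\<^sup>2 - \<beta>\<^sup>2 / 4" using R(2) by simp
  have Tp': "Tp\<^sup>2 = (\<beta>\<^sup>2 / 2 - m - e) / 4" and Tm': "Tm\<^sup>2 = (\<beta>\<^sup>2 / 2 - m + e) / 4"
    unfolding e_def Tp[symmetric] Tm[symmetric] by simp_all
  have z: "z = x - \<beta> / 4" by (simp add: x_def)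
  have "(z - (- \<beta> / 4 + R + Tp)) * (z - (- \<beta> / 4 - R + Tm)) * (z - (- \<beta> / 4 + R - Tp)) * (z - (- \<beta> / 4 - R - Tm))
    = ((x - R)\<^sup>2 - Tp\<^sup>2) * ((x + R)\<^sup>2 - Tm\<^sup>2)"
    unfolding z by (simp add: algebra_simps power2_eq_square)
  also have "\<dots> = ((x - R)\<^sup>2 - (3 * \<beta>\<^sup>2 / 16 - R\<^sup>2 - e / 4)) * ((x + R)\<^sup>2 - (3 * \<beta>\<^sup>2 / 16 - R\<^sup>2 + e / 4))"
    unfolding Tp' Tm' m' by (simp add: field_simps)
  also have "\<dots> = x ^ 4 - 3 * \<beta>\<^sup>2 / 8 * x\<^sup>2 + R * e * x + ((2 * R\<^sup>2 - 3 * \<beta>\<^sup>2 / 16)\<^sup>2 - e\<^sup>2 / 16)"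
    by (simp add: power2_eq_square power4_eq_xxxx field_simps)
  also have "R * e = \<beta> ^ 3 / 8" using eR by (simp add: field_simps)
  also have "(2 * R\<^sup>2 - 3 * \<beta>\<^sup>2 / 16)\<^sup>2 - e\<^sup>2 / 16 = \<gamma> - 3 * \<beta> ^ 4 / 256"
  proof -
    have e2: "64 * R\<^sup>2 * e\<^sup>2 = \<beta> ^ 6"
    proof -
      have "64 * R\<^sup>2 * e\<^sup>2 = (8 * R * e)\<^sup>2" by (simp add: power2_eq_square)
      then show ?thesis by (simp add: eR flip: power_mult)
    qed
    have g: "(4 * R\<^sup>2 - \<beta>\<^sup>2 / 4) ^ 3 = 16 * \<gamma> * R\<^sup>2" using m unfolding m' by simp
    have "1024 * R\<^sup>2 * ((2 * R\<^sup>2 - 3 * \<beta>\<^sup>2 / 16)\<^sup>2 - e\<^sup>2 / 16) = 1024 * R\<^sup>2 * (2 * R\<^sup>2 - 3 * \<beta>\<^sup>2 / 16)\<^sup>2 - \<beta> ^ 6"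
      using e2 by (simp add: algebra_simps)
    also have "\<dots> = 64 * (4 * R\<^sup>2 - \<beta>\<^sup>2 / 4) ^ 3 - 1024 * R\<^sup>2 * (3 * \<beta> ^ 4 / 256)"
      by (simp add: power2_eq_square power3_eq_cube power4_eq_xxxx power_numeral_reduce field_simps)
    also have "\<dots> = 1024 * R\<^sup>2 * (\<gamma> - 3 * \<beta> ^ 4 / 256)" unfolding g by (simp add: algebra_simps)
    finally show ?thesis using R(1) by simp
  qed
  also have "x ^ 4 - 3 * \<beta>\<^sup>2 / 8 * x\<^sup>2 + \<beta> ^ 3 / 8 * x + (\<gamma> - 3 * \<beta> ^ 4 / 256) = z ^ 4 + \<beta> * z ^ 3 + \<gamma>"
    unfolding x_def by (simp add: power2_eq_square power3_eq_cube power4_eq_xxxx field_simps)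
  finally show ?thesis .
qed

context bagley_torvik
begin

definition beta :: complex ("\<beta>") where "\<beta> = complex_of_real (b / a)"
definition gamma :: complex ("\<gamma>") where "\<gamma> = complex_of_real (c / a)"

lemmas fold_coeffs = Let_def beta_def[symmetric] gamma_def[symmetric]

text \<open>Cardano's solution \<open>u + v\<close> of the resolvent cubic, with \<open>u v = 4 \<gamma> / 3\<close>.\<close>

definition cardano :: "complex \<Rightarrow> complex" where
  "cardano \<kappa> = \<kappa> / of_real (root 3 18) + 8 * \<gamma> / (of_real (root 3 12) * \<kappa>)"

lemma gamma_nz: "\<gamma> \<noteq> 0" unfolding gamma_def using a_nz c_nz by simp

lemma delta_eq: "(bt_delta a b c)\<^sup>2 - 18 * \<beta>\<^sup>2 * \<gamma> * bt_delta a b c + 768 * \<gamma> ^ 3 = 0"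
proof -
  define s where "s = csqrt (81 * \<beta> ^ 4 - 768 * \<gamma>)"
  have s: "s\<^sup>2 = 81 * \<beta> ^ 4 - 768 * \<gamma>" unfolding s_def by (rule power2_csqrt)
  have d: "bt_delta a b c = (9 * \<beta>\<^sup>2 + s) * \<gamma>" unfolding bt_delta_def s_def fold_coeffs ..
  have "(bt_delta a b c)\<^sup>2 - 18 * \<beta>\<^sup>2 * \<gamma> * bt_delta a b c + 768 * \<gamma> ^ 3 = \<gamma>\<^sup>2 * (s\<^sup>2 - 81 * \<beta> ^ 4 + 768 * \<gamma>)"
    unfolding d by (simp add: power2_eq_square power3_eq_cube power4_eq_xxxx algebra_simps)
  then show ?thesis unfolding s by simp
qed

lemma delta_nz: "bt_delta a b c \<noteq> 0"
proof
  assume "bt_delta a b c = 0"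
  then show False using delta_eq gamma_nz by simp
qed

text \<open>Since \<open>3 u v = 4 \<gamma>\<close>, the cubic reduces to \<open>u^3 + v^3 = \<gamma> \<beta>^2\<close>, which is the quadratic
  equation for \<open>\<delta>\<close>.\<close>

lemma cardano_cubic:
  assumes k: "\<kappa> ^ 3 = bt_delta a b c"
  shows "cardano \<kappa> ^ 3 = \<gamma> * (\<beta>\<^sup>2 + 4 * cardano \<kappa>)"
proof -
  let ?d = "bt_delta a b c"
  have knz: "\<kappa> \<noteq> 0" using k delta_nz by auto
  define u v where "u = \<kappa> / of_real (root 3 18)" and "v = 8 * \<gamma> / (of_real (root 3 12) * \<kappa>)"
  have "root 3 18 * root 3 12 = root 3 216" by (simp flip: real_root_mult)
  also have "root 3 216 = 6" by (rule real_root_pos_unique) auto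
  finally have "complex_of_real (root 3 18) * of_real (root 3 12) = 6" by (simp flip: of_real_mult)
  then have uv: "u * v = 4 / 3 * \<gamma>" unfolding u_def v_def using knz by (simp add: field_simps)
  have u3: "u ^ 3 = ?d / 18" unfolding u_def by (simp add: power_divide k root3_of_real_cube)
  have v3: "v ^ 3 = 512 * \<gamma> ^ 3 / (12 * ?d)"
    unfolding v_def by (simp add: power_divide power_mult_distrib k root3_of_real_cube)
  have "u ^ 3 + v ^ 3 = \<gamma> * \<beta>\<^sup>2"
  proof -
    have "18 * ?d * (u ^ 3 + v ^ 3) = ?d\<^sup>2 + 768 * \<gamma> ^ 3"
      unfolding u3 v3 using delta_nz by (simp add: field_simps power2_eq_square)
    also have "\<dots> = 18 * ?d * (\<gamma> * \<beta>\<^sup>2)" using delta_eq by (simp add: algebra_simps)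
    finally show ?thesis using delta_nz by (subst (asm) mult_left_cancel) auto
  qed
  moreover have "(u + v) ^ 3 = u ^ 3 + v ^ 3 + 3 * (u * v) * (u + v)"
    by (simp add: power3_eq_cube algebra_simps)
  ultimately show ?thesis unfolding cardano_def u_def[symmetric] v_def[symmetric] uv
    by (simp add: algebra_simps)
qed

lemma bt_R_square: "4 * (bt_R a b c \<kappa>)\<^sup>2 = \<beta>\<^sup>2 / 4 + cardano \<kappa>"
  unfolding bt_R_def fold_coeffs cardano_def by (simp add: power_mult_distrib power_divide add.assoc)

lemma bt_T_square:
  assumes "\<kappa> \<noteq> 0"
  shows "4 * (bt_T a b c \<kappa> s)\<^sup>2 = \<beta>\<^sup>2 / 2 - cardano \<kappa> - s * (\<beta> ^ 3 / (8 * bt_R a b c \<kappa>))"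
proof -
  have "root 3 (2/3) * root 3 12 = root 3 8" by (simp flip: real_root_mult)
  also have "root 3 8 = 2" by (rule real_root_pos_unique) auto
  finally have "complex_of_real (root 3 (2/3)) * of_real (root 3 12) = 2"
    by (simp flip: of_real_mult)
  then have p: "complex_of_real (root 3 (2/3)) = 2 / of_real (root 3 12)" by (simp add: field_simps)
  have "4 * \<gamma> * (of_real (root 3 (2/3)) / \<kappa>) = 8 * \<gamma> / (of_real (root 3 12) * \<kappa>)"
    unfolding p by simp
  then show ?thesis
    unfolding bt_T_def fold_coeffs cardano_def
    by (simp add: power_mult_distrib power_divide diff_diff_eq add.commute)
qed

lemma bt_root_bij:
  assumes k: "\<kappa> ^ 3 = bt_delta a b c" and R: "bt_R a b c \<kappa> \<noteq> 0"
  shows "bij_betw (bt_root a b c \<kappa>) {1..4} {z. bt_poly a b c z = 0}"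
proof -
  have knz: "\<kappa> \<noteq> 0" using k delta_nz by auto
  have az: "complex_of_real a \<noteq> 0" using a_nz by simp
  let ?x = "bt_root a b c \<kappa>"
  have fac: "(z - ?x 1) * (z - ?x 2) * (z - ?x 3) * (z - ?x 4) = z ^ 4 + \<beta> * z ^ 3 + \<gamma>" for z
    using ferrari_identity[OF cardano_cubic[OF k] R bt_R_square, of "bt_T a b c \<kappa> 1" "bt_T a b c \<kappa> (-1)" z]
    unfolding bt_root_def fold_coeffs by (simp add: bt_T_square[OF knz])
  have "bt_poly a b c z = of_real a * (z ^ 4 + \<beta> * z ^ 3 + \<gamma>)" for z
    using az by (simp add: bt_poly_def beta_def gamma_def field_simps)
  then have "{z. bt_poly a b c z = 0} = {?x 1, ?x 2, ?x 3, ?x 4}"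
    unfolding fac[symmetric] using az by auto
  also have "\<dots> = ?x ` {1..4}"
  proof -
    have "{1..4::nat} = {1, 2, 3, 4}" by auto
    then show ?thesis by simp
  qed
  finally have im: "?x ` {1..4} = {z. bt_poly a b c z = 0}" ..
  \<comment> \<open>The four values exhaust a set of four roots, so they are distinct.\<close>
  moreover have "inj_on ?x {1..4}"
  proof (rule eq_card_imp_inj_on)
    show "card (?x ` {1..4}) = card {1..4::nat}" unfolding im using bij_betw_same_card[OF roots] by simp
  qed simp
  ultimately show ?thesis by (simp add: bij_betw_def)
qed

text \<open>If \<open>R = 0\<close>, the cubic forces \<open>\<beta> = 0\<close> and \<open>m = 0\<close>, and then \<open>\<kappa>^2\<close> is real. But \<open>\<delta>\<close> is a
  positive multiple of \<open>\<i>\<close> or a negative real, so the argument of \<open>\<kappa>^2\<close> is \<open>pi / 3\<close> or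
  \<open>2 pi / 3\<close>.\<close>

lemma bt_R_principal_nz: "bt_R a b c (bt_delta a b c powr (1/3)) \<noteq> 0"
proof
  let ?d = "bt_delta a b c"
  define \<kappa> where "\<kappa> = ?d powr (1/3)"
  assume R0: "bt_R a b c (?d powr (1/3)) = 0"
  have kexp: "\<kappa> = exp (Ln ?d / 3)" using delta_nz by (simp add: \<kappa>_def powr_def)
  have k3: "\<kappa> ^ 3 = ?d" using delta_nz unfolding kexp by (simp flip: exp_of_nat_mult)
  have knz: "\<kappa> \<noteq> 0" by (simp add: kexp)
  have m: "\<beta>\<^sup>2 + 4 * cardano \<kappa> = 0"
  proof -
    have "X + 4 * Y = 0" if "4 * 0\<^sup>2 = X / 4 + Y" for X Y :: complex
    proof -
      have "X + 4 * Y = 4 * (X / 4 + Y)" by (simp add: ring_distribs)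
      then show ?thesis unfolding that[symmetric] by simp
    qed
    then show ?thesis using bt_R_square[of \<kappa>] unfolding R0[folded \<kappa>_def] by blast
  qed
  then have m0: "cardano \<kappa> = 0" using cardano_cubic[OF k3] by simp
  then have "\<beta> = 0" using m by simp
  then have d: "?d = csqrt (- 768 * \<gamma>) * \<gamma>" unfolding bt_delta_def fold_coeffs by simp
  have r: "complex_of_real (root 3 12) \<noteq> 0" "complex_of_real (root 3 18) \<noteq> 0" by auto
  have "\<kappa>\<^sup>2 = - 8 * \<gamma> * of_real (root 3 18) / of_real (root 3 12)"
    using m0 knz r unfolding cardano_def by (simp add: field_simps power2_eq_square eq_neg_iff_add_eq_0)
  then have "\<kappa>\<^sup>2 = complex_of_real (- 8 * (c / a) * root 3 18 / root 3 12)" by (simp add: gamma_def)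
  then have im: "Im (\<kappa>\<^sup>2) = 0" by (metis Im_complex_of_real)
  have "\<kappa>\<^sup>2 = exp (2 * Ln ?d / 3)" unfolding kexp by (simp flip: exp_double)
  then have "Im (\<kappa>\<^sup>2) = exp (Re (2 * Ln ?d / 3)) * sin (2 * Im (Ln ?d) / 3)"
    by (simp add: Im_exp)
  then have s0: "sin (2 * Im (Ln ?d) / 3) = 0" using im by simp
  show False
  proof (cases "c / a > 0")
    case True
    have "csqrt (- 768 * \<gamma>) = \<i> * of_real (sqrt (768 * (c / a)))"
    proof (rule csqrt_unique)
      have "(complex_of_real (sqrt (768 * (c / a))))\<^sup>2 = of_real (768 * (c / a))"
        using True by (simp only: of_real_power[symmetric]) simp
      then show "(\<i> * complex_of_real (sqrt (768 * (c / a))))\<^sup>2 = - 768 * \<gamma>"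
        by (simp add: power_mult_distrib gamma_def)
    qed (use True in simp)
    then have d': "?d = of_real (sqrt (768 * (c / a)) * (c / a)) * \<i>" unfolding d by (simp add: gamma_def)
    have "sqrt (768 * (c / a)) * (c / a) > 0" using True by (intro mult_pos_pos) auto
    moreover have "Im (Ln (of_real S * \<i>)) = pi / 2" if "S > 0" for S
      using that by (simp add: Ln_times_of_real)
    ultimately have L: "Im (Ln ?d) = pi / 2" unfolding d' by blast
    have "sin (pi / 3) = 0" using s0 unfolding L by simp
    then show False by (simp add: sin_60)
  next
    case False
    then have neg: "c / a < 0" using a_nz c_nz by (metis divide_eq_0_iff linorder_neqE_linordered_idom)
    have "csqrt (- 768 * \<gamma>) = of_real (sqrt (- 768 * (c / a)))"
    proof -
      have "- 768 * \<gamma> = of_real (- 768 * (c / a))" by (simp add: gamma_def)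
      moreover have "- 768 * (c / a) \<ge> 0" using neg by linarith
      ultimately show ?thesis by (simp only: of_real_sqrt)
    qed
    then have "?d = of_real (sqrt (- 768 * (c / a)) * (c / a))" unfolding d by (simp add: gamma_def)
    moreover have "sqrt (- 768 * (c / a)) * (c / a) < 0" using neg by (intro mult_pos_neg) auto
    moreover have "Im (Ln (of_real S)) = pi" if "S < 0" for S
      using that Im_Ln_eq_pi[of "of_real S"] by simp
    ultimately have L: "Im (Ln ?d) = pi" by metis
    have "sin (2 * pi / 3) = 0" using s0 unfolding L .
    then show False by (simp add: sin_120)
  qed
qed

end

theorem theorem6:
  fixes a b c y0 y1 :: real and f :: "real \<Rightarrow> real" and r :: "nat \<Rightarrow> complex"
  assumes "a \<noteq> 0"
    and roots: "bij_betw r {1..4} {z. bt_poly a b c z = 0}"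
    and force: "\<And>t. t > 0 \<Longrightarrow> f absolutely_integrable_on {0..t}"
  shows "(\<forall>t\<ge>0. bt_force_part a b r f t + bt_initial_part a b r y0 y1 t \<in> \<real>) \<and>
     (\<forall>y. bt_solution a b c f y0 y1 y \<longleftrightarrow>
       (\<forall>t\<ge>0. complex_of_real (y t) =
          bt_force_part a b r f t + bt_initial_part a b r y0 y1 t)) \<and>
     (continuous_on {0<..} f \<longrightarrow>
       (\<forall>y. bt_solution a b c f y0 y1 y \<longrightarrow> (\<forall>t>0. bt_equation_at a b c f y t))) \<and>
     (\<forall>\<kappa>. \<kappa> ^ 3 = bt_delta a b c \<and> bt_R a b c \<kappa> \<noteq> 0 \<longrightarrow>
       bij_betw (bt_root a b c \<kappa>) {1..4} {z. bt_poly a b c z = 0}) \<and>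
     bt_R a b c (bt_delta a b c powr (1/3)) \<noteq> 0"
proof -
  interpret bagley_torvik a b c r using assms(1) roots by unfold_locales
  obtain v where v: "(\<lambda>x. complex_of_real (v x)) \<in> causal_loc_int"
    "AE x in lborel. x > 0 \<longrightarrow> v x = f x" "continuous_on {0<..} f \<longrightarrow> (\<forall>x>0. v x = f x)"
    using borel_representative[OF force] by metis
  define h where "h = acceleration (\<lambda>x. complex_of_real (v x)) y0 y1"
  let ?Y = "\<lambda>t. y0 + y1 * t + Re (conv heaviside (conv heaviside h) t)"
  have formula: "bt_force_part a b r f t + bt_initial_part a b r y0 y1 t = of_real (?Y t)" if "t \<ge> 0" for t
    unfolding force_part_conv[OF v(1,2)] h_def by (rule acceleration_formula[OF v(1) _ that]) simp
  have eq: "complex_of_real (y t) = bt_force_part a b r f t + bt_initial_part a b r y0 y1 t \<longleftrightarrow> y t = ?Y t"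
    if "t \<ge> 0" for y t
    unfolding formula[OF that] by (rule of_real_eq_iff)
  have real: "\<forall>t\<ge>0. bt_force_part a b r f t + bt_initial_part a b r y0 y1 t \<in> \<real>"
  proof (intro allI impI)
    fix t :: real assume "t \<ge> 0"
    show "bt_force_part a b r f t + bt_initial_part a b r y0 y1 t \<in> \<real>"
      unfolding formula[OF \<open>t \<ge> 0\<close>] by (rule Reals_of_real)
  qed
  have only: "y t = ?Y t" if "bt_solution a b c f y0 y1 y" "t \<ge> 0" for y t
    unfolding h_def by (rule solution_imp_acceleration[OF v(1,2) that])
  have converse: "bt_solution a b c f y0 y1 y" if "\<And>t. t \<ge> 0 \<Longrightarrow> y t = ?Y t" for y
    by (rule acceleration_imp_solution[OF v(1,2) h_def that])
  have iff: "bt_solution a b c f y0 y1 y \<longleftrightarrow>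
       (\<forall>t\<ge>0. complex_of_real (y t) = bt_force_part a b r f t + bt_initial_part a b r y0 y1 t)" for y
    using only[of y] converse[of y] eq[of _ y] by blast
  have pointwise: "bt_equation_at a b c f y t"
    if "continuous_on {0<..} f" "bt_solution a b c f y0 y1 y" "t > 0" for y t
    by (rule acceleration_equation_everywhere[OF v(1) _ that(1) h_def only[OF that(2)] that(3)])
      (use v(3) that(1) in blast)
  show ?thesis using real iff pointwise bt_root_bij bt_R_principal_nz by blast
qed

end
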